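(* Let $d'\ge 1$ be an integer, let $a,b,c,d\in\mathbb{R}$ with $ad-bc=1$ and $b\neq 0$, and write $A=(a,b,c,d)$. Let $m,n\in\mathbb{R}_{>0}^{d'}$ and let $0\neq\varphi\in\mathcal{O}_m^n(\mathbb{C}^{d'})$ be a window function. Let $\tau,v\in\mathbb{R}_{>0}^{d'}$ satisfy $$\tau_j<\frac{1}{\sqrt{2n_j e}},\qquad v_j<b\sqrt{\frac{2m_j}{e}},\qquad j\in\{1,\dots,d'\},$$ and let $\Lambda=S\,(\sqrt{\mathbb{Z}})^{2d'}\subset\mathbb{R}^{2d'}$ be the rectangular square-root lattice generated by the matrix $S=\mathrm{diag}(\tau_1,\dots,\tau_{d'},v_1,\dots,v_{d'})$. Then for every $f,h\in L^2(\mathbb{R}^{d'})$ the following statements are equivalent: (1) $|V_\varphi^{(A)}f(\lambda)|=|V_\varphi^{(A)}h(\lambda)|$ for every $\lambda\in\Lambda$; (2) $f\sim h$.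
   Context: For $m,n\in\mathbb{R}_{>0}^{d'}$, $\mathcal{O}_m^n(\mathbb{C}^{d'})$ denotes the set of all entire functions $F:\mathbb{C}^{d'}\to\mathbb{C}$ for which there is a constant $C>0$ with $|F(x+iy)|\le C\prod_{j=1}^{d'}e^{-m_jx_j^2}e^{n_jy_j^2}$ for all $x,y\in\mathbb{R}^{d'}$. Such functions are identified with their restrictions to $\mathbb{R}^{d'}$, which lie in $L^2(\mathbb{R}^{d'})$. For $A=(a,b,c,d)$ with $ad-bc=1$, $b\ne0$, the short-time linear canonical transform (STLCT) of $f\in L^2(\mathbb{R}^{d'})$ with window $g\in L^2(\mathbb{R}^{d'})$ is $$V_g^{(A)}f(x,\mu)=\frac{1}{\sqrt b}\int_{\mathbb{R}^{d'}}e^{i\left(\frac{a}{2b}t^2-\frac1b t\mu+\frac{d}{2b}\mu^2\right)}\,\overline{g(t-x)}\,f(t)\,dt,\qquad (x,\mu)\in\mathbb{R}^{d'}\times\mathbb{R}^{d'},$$ where $t^2=\sum_j t_j^2$, $t\mu=\sum_j t_j\mu_j$, $\mu^2=\sum_j\mu_j^2$. $\sqrt{\mathbb{Z}}:=\{\pm\sqrt{k}:k\in\mathbb{N}_0\}$. A point $\lambda\in\mathbb{R}^{2d'}$ is read as $(x,\mu)$ with $x$ the first $d'$ and $\mu$ the last $d'$ coordinates. $f\sim h$ means that $f=\tau_0 h$ (almost everywhere) for some $\tau_0\in\mathbb{C}$ with $|\tau_0|=1$. *)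

theory Defs
  imports "HOL-Analysis.Analysis"
begin

text \<open>
  Holomorphic on all of \<open>\<complex>\<^sup>d\<close>: Frechet differentiable at every point, with a derivative that is
  linear over the complex numbers (\<open>has_derivative\<close> by itself only gives real linearity).
\<close>

definition entire_fun :: "(complex ^ 'd \<Rightarrow> complex) \<Rightarrow> bool" where
  "entire_fun F \<longleftrightarrow>
     (\<forall>z. \<exists>D. (F has_derivative D) (at z) \<and> (\<forall>k w. D (k *s w) = k * D w))"

definition O_space :: "real ^ 'd \<Rightarrow> real ^ 'd \<Rightarrow> (complex ^ 'd \<Rightarrow> complex) set" where
  "O_space m n = {F. entire_fun F \<and>
     (\<exists>C>0. \<forall>x y :: real ^ 'd.
        cmod (F (\<chi> j. complex_of_real (x $ j) + \<i> * complex_of_real (y $ j)))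
          \<le> C * (\<Prod>j\<in>UNIV. exp (- (m $ j) * (x $ j)\<^sup>2) * exp (n $ j * (y $ j)\<^sup>2)))}"

definition real_restriction :: "(complex ^ 'd \<Rightarrow> complex) \<Rightarrow> real ^ 'd \<Rightarrow> complex" where
  "real_restriction F x = F (\<chi> j. complex_of_real (x $ j))"

text \<open>Elements of \<open>L\<^sup>2\<close> are represented by functions; equality in \<open>L\<^sup>2\<close> is equality almost everywhere.\<close>

definition L2_fun :: "(real ^ 'd \<Rightarrow> complex) \<Rightarrow> bool" where
  "L2_fun f \<longleftrightarrow> f \<in> borel_measurable lebesgue \<and> integrable lebesgue (\<lambda>t. (cmod (f t))\<^sup>2)"

definition phase_equiv :: "(real ^ 'd \<Rightarrow> complex) \<Rightarrow> (real ^ 'd \<Rightarrow> complex) \<Rightarrow> bool"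
    (infix "\<sim>\<^sub>p" 50) where
  "f \<sim>\<^sub>p h \<longleftrightarrow> (\<exists>\<tau>\<^sub>0 :: complex. cmod \<tau>\<^sub>0 = 1 \<and> (AE t in lebesgue. f t = \<tau>\<^sub>0 * h t))"

text \<open>For negative \<open>b\<close> the factor uses the principal complex square root.\<close>

fun STLCT :: "real \<times> real \<times> real \<times> real \<Rightarrow> (real ^ 'd \<Rightarrow> complex) \<Rightarrow> (real ^ 'd \<Rightarrow> complex)
    \<Rightarrow> (real ^ 'd) \<times> (real ^ 'd) \<Rightarrow> complex" where
  "STLCT (a, b, c, d) g f (x, \<mu>) =
     1 / csqrt (complex_of_real b) *
     (LINT t|lebesgue.
        exp (\<i> * complex_of_real
               (a / (2 * b) * (t \<bullet> t) - 1 / b * (t \<bullet> \<mu>) + d / (2 * b) * (\<mu> \<bullet> \<mu>)))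
        * cnj (g (t - x)) * f t)"

definition sqrt_ints :: "real set" where
  "sqrt_ints = {s * sqrt (real k) | s k. s \<in> {1, -1}}"

text \<open>
  \<open>\<real>\<^sup>2\<^sup>d\<close> is indexed by the sum type \<open>'d + 'd\<close>: the first \<open>d\<close> coordinates are the \<open>Inl\<close> ones,
  the last \<open>d\<close> coordinates are the \<open>Inr\<close> ones.
\<close>

definition split_point :: "real ^ ('d + 'd) \<Rightarrow> (real ^ 'd) \<times> (real ^ 'd)" where
  "split_point p = ((\<chi> j. p $ Inl j), (\<chi> j. p $ Inr j))"

definition diag_matrix :: "real ^ 'd \<Rightarrow> real ^ 'd \<Rightarrow> real ^ ('d + 'd) ^ ('d + 'd)" where
  "diag_matrix \<tau> v =
     (\<chi> i k. if i = k then (case i of Inl j \<Rightarrow> \<tau> $ j | Inr j \<Rightarrow> v $ j) else 0)"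

definition sqrt_lattice :: "real ^ 'k ^ 'k \<Rightarrow> (real ^ 'k) set" where
  "sqrt_lattice S = (\<lambda>z. S *v z) ` {z. \<forall>i. z $ i \<in> sqrt_ints}"

end

theory Submission
  imports Defs "HOL-Probability.Levy" "HOL-Complex_Analysis.Complex_Singularities"
begin

text \<open>
  Up to chirps, a dilation and conjugation, the transform is
  \<open>V f (x, w) = \<integral> exp (i t w) \<phi> (t - x) cnj (f t) dt\<close>. Along a real line with direction \<open>(\<alpha>, \<beta>)\<close> it
  extends to an entire function, and completing the square in the Gaussian bound on \<open>\<phi>\<close> shows that
  \<open>V f z * cnj (V f (cnj z))\<close> is at most a constant times \<open>exp (2 (\<Sum> n\<^sub>j \<alpha>\<^sub>j\<^sup>2 + \<beta>\<^sub>j\<^sup>2 / (4 m\<^sub>j)) (Im z)\<^sup>2)\<close>.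
  On the real line this product is \<open>(cmod (V f))\<^sup>2\<close>. An entire function of such growth with zeros at
  \<open>\<plusminus>\<tau>\<surd>k\<close> vanishes identically for small \<open>\<tau>\<close>, so applying this to one coordinate after the other
  extends \<open>cmod (V f) = cmod (V h)\<close> from the lattice to all real points. There, two applications of the Fourier
  uniqueness theorem give \<open>f t * cnj (f u) = h t * cnj (h u)\<close> almost everywhere: the Fourier
  transform of \<open>(cmod (V f))\<^sup>2\<close> is the ambiguity function of \<open>f\<close> times that of \<open>\<phi>\<close>, and the latter is
  nonzero on a dense set because it is analytic.
\<close>

section \<open>Fourier uniqueness\<close>

text \<open>The bounds on \<tau> and v are one inequality. Growth
  \<open>exp (\<sigma> * (norm z)^2)\<close> and zeros at \<open>\<plusminus>\<tau>\<surd>k\<close>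
  force vanishing once \<open>\<sigma> * \<tau>^2 * exp 1 < 1\<close>. Moving a position coordinate
  costs \<sigma> = 2 n_j. Moving a frequency coordinate, which enters the kernel divided by b, costs
  \<sigma> = 1 / (2 m_j b^2). Solving for the spacing gives the two hypotheses. The number e arises
  when a circle of squared radius \<tau>^2 c N is used to divide out N pairs of zeros: the gain is
  at least c^N, the loss is exp (\<sigma> \<tau>^2 c N), and (ln c) / c is largest at c = e. Two
  obstacles shape the rest. \<open>V f\<close> alone carries a factor exp (- Im z * ...) that
  depends on the line; multiplying by the reflected function cancels it, so one growth rate serves
  all parallel lines. And Fourier uniqueness in the lag holds only outside a null set that depends
  on the sampling point x, so it is used for countably many x and extended by continuity.\<close>

lemma integrable_gaussian:
  fixes r :: real
  assumes "r > 0"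
  shows "integrable lborel (\<lambda>t::'a::euclidean_space. exp (- r * (t \<bullet> t)))"
proof -
  \<comment> \<open>The normal density of variance 1 / (2 r) is a multiple of exp (- r x^2); higher
    dimensions follow from Tonelli over \<open>Basis\<close>.\<close>
  have "integrable lborel (normal_density 0 (1 / sqrt (2 * r)))"
    using assms by (intro integrable_normal_density) auto
  then have "integrable lborel (\<lambda>x. sqrt (pi / r) * normal_density 0 (1 / sqrt (2 * r)) x)"
    by simp
  also have "(\<lambda>x. sqrt (pi / r) * normal_density 0 (1 / sqrt (2 * r)) x) = (\<lambda>x. exp (- r * x\<^sup>2))"
    using assms by (auto simp: normal_density_def fun_eq_iff power_divide real_sqrt_divide field_simps)
  finally have 1: "integrable lborel (\<lambda>x. exp (- r * x\<^sup>2))" .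
  then have 2: "(\<integral>\<^sup>+x. ennreal (exp (- r * x\<^sup>2)) \<partial>lborel) < \<infinity>"
    by (simp add: integrable_iff_bounded)
  have eq: "exp (- r * (t \<bullet> t)) = (\<Prod>b\<in>Basis. exp (- r * (t \<bullet> b)\<^sup>2))" for t :: 'a
  proof -
    have "t \<bullet> t = (\<Sum>b\<in>Basis. (t \<bullet> b)\<^sup>2)"
      by (subst euclidean_inner) (simp add: power2_eq_square)
    then show ?thesis
      by (simp add: exp_sum[symmetric] sum_distrib_left)
  qed
  have "(\<integral>\<^sup>+t. ennreal (exp (- r * (t \<bullet> t))) \<partial>(lborel::'a measure))
      = (\<integral>\<^sup>+t. (\<Prod>b\<in>Basis. ennreal (exp (- r * (t \<bullet> b)\<^sup>2))) \<partial>(lborel::'a measure))"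
    unfolding eq by (simp add: prod_ennreal)
  also have "\<dots> = (\<Prod>b\<in>(Basis::'a set). (\<integral>\<^sup>+x. ennreal (exp (- r * x\<^sup>2)) \<partial>lborel))"
    by (rule nn_integral_lborel_prod[of "\<lambda>_ x. ennreal (exp (- r * x\<^sup>2))"]) auto
  also have "\<dots> < \<infinity>"
    using 2 by (simp add: power_less_top_ennreal)
  finally show ?thesis
    by (intro integrableI_bounded) auto
qed

lemma borel_measurable_cnj [measurable]: "cnj \<in> borel_measurable borel"
  by (intro borel_measurable_continuous_onI continuous_intros)

text \<open>The positive and negative parts of \<kappa>, normalised and pushed forward along
  \<open>X\<close>, are probability laws on the line with the same characteristic function, so
  Levy's uniqueness theorem identifies them. \<open>M\<close> stays abstract so that
  \<open>X\<close> can later be one coordinate of a higher-dimensional space.\<close>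

lemma real_fourier_uniqueness_projection:
  fixes X \<kappa> :: "'a \<Rightarrow> real"
  assumes X[measurable]: "X \<in> borel_measurable M" and \<kappa>: "integrable M \<kappa>"
    and zero: "\<And>w. (LINT t|M. iexp (w * X t) * complex_of_real (\<kappa> t)) = 0"
    and B[measurable]: "B \<in> sets borel"
  shows "(LINT t|M. indicator B (X t) * \<kappa> t) = 0"
proof -
  note [measurable] = borel_measurable_integrable[OF \<kappa>]
  define p where "p = (\<lambda>t. max 0 (\<kappa> t))"
  define q where "q = (\<lambda>t. max 0 (- \<kappa> t))"
  have pq: "\<kappa> t = p t - q t" "p t \<ge> 0" "q t \<ge> 0" for t
    by (auto simp: p_def q_def)
  have [measurable]: "p \<in> borel_measurable M" "q \<in> borel_measurable M"
    by (auto simp: p_def q_def)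
  have ip: "integrable M p" and iq: "integrable M q"
    unfolding p_def q_def using \<kappa> by auto
  \<comment> \<open>Frequency 0 shows that both parts have the same mass \<open>s\<close>. If it is
    0 there is nothing to normalise, hence the case split below.\<close>
  define s where "s = integral\<^sup>L M p"
  have "(LINT t|M. complex_of_real (\<kappa> t)) = 0"
    using zero[of 0] by simp
  then have "integral\<^sup>L M \<kappa> = 0"
    by simp
  then have sq: "integral\<^sup>L M q = s"
    using ip iq Bochner_Integration.integral_diff[OF ip iq] by (simp add: pq(1)[symmetric] s_def)
  have s0: "s \<ge> 0"
    unfolding s_def using pq by (intro Bochner_Integration.integral_nonneg) auto
  have I1: "integrable M (\<lambda>t. indicator B (X t) * p t)" "integrable M (\<lambda>t. indicator B (X t) * q t)"
    by (rule Bochner_Integration.integrable_bound[OF ip]; auto simp: indicator_def pq)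
       (rule Bochner_Integration.integrable_bound[OF iq]; auto simp: indicator_def pq)
  show ?thesis
  proof (cases "s = 0")
    case True
    then have "AE t in M. p t = 0" "AE t in M. q t = 0"
      using ip iq pq sq integral_nonneg_eq_0_iff_AE[of M p] integral_nonneg_eq_0_iff_AE[of M q]
      by (auto simp: s_def)
    then have "AE t in M. indicator B (X t) * \<kappa> t = 0"
      by eventually_elim (simp add: pq(1))
    then show ?thesis
      by (intro integral_eq_zero_AE)
  next
    case False
    with s0 have s: "s > 0" by simp
    define D where "D = (\<lambda>u. distr (density M (\<lambda>t. ennreal (u t / s))) borel X)"
    have dist: "real_distribution (D u)"
      if u: "integrable M u" "\<And>t. u t \<ge> 0" "integral\<^sup>L M u = s" for u
    proof -
      note [measurable] = borel_measurable_integrable[OF u(1)]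
      have "emeasure (density M (\<lambda>t. ennreal (u t / s))) (space M) = (\<integral>\<^sup>+t. ennreal (u t / s) \<partial>M)"
        by (subst emeasure_density) (auto intro!: nn_integral_cong)
      also have "\<dots> = ennreal (LINT t|M. u t / s)"
        using u s by (intro nn_integral_eq_integral) auto
      also have "\<dots> = 1"
        using u s by simp
      finally have "prob_space (density M (\<lambda>t. ennreal (u t / s)))"
        by (intro prob_spaceI) simp
      then interpret prob_space "density M (\<lambda>t. ennreal (u t / s))" .
      show ?thesis
        unfolding D_def real_distribution_def real_distribution_axioms_def
        by (auto intro!: prob_space_distr)
    qed
    have char: "char (D u) w = (LINT t|M. iexp (w * X t) * complex_of_real (u t)) / s"
      if u: "integrable M u" "\<And>t. u t \<ge> 0" for u w
    proof -
      note [measurable] = borel_measurable_integrable[OF u(1)]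
      have "char (D u) w = (LINT t|M. (u t / s) *\<^sub>R iexp (w * X t))"
        unfolding char_def D_def using u s by (simp add: integral_distr integral_density)
      also have "\<dots> = (LINT t|M. iexp (w * X t) * complex_of_real (u t) / s)"
        by (intro Bochner_Integration.integral_cong) (auto simp: scaleR_conv_of_real)
      finally show ?thesis by simp
    qed
    have int: "integrable M (\<lambda>t. iexp (w * X t) * complex_of_real (u t))"
      if u: "integrable M u" for u w
    proof -
      note [measurable] = borel_measurable_integrable[OF u(1)]
      show ?thesis
        by (rule Bochner_Integration.integrable_bound[OF u]) (auto simp: norm_mult)
    qed
    have "char (D p) = char (D q)"
    proof
      fix w
      have "(LINT t|M. iexp (w * X t) * complex_of_real (p t))
          - (LINT t|M. iexp (w * X t) * complex_of_real (q t)) = 0"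
        using zero[of w] int[OF ip, of w] int[OF iq, of w]
        by (subst Bochner_Integration.integral_diff[symmetric]) (auto simp: pq(1) algebra_simps)
      then show "char (D p) w = char (D q) w"
        using char[OF ip, of w] char[OF iq, of w] pq by simp
    qed
    then have eq: "D p = D q"
      by (intro Levy_uniqueness dist) (auto simp: ip iq pq sq s_def)
    have meas: "(LINT x|D u. indicator B x) = (LINT t|M. indicator B (X t) * u t) / s"
      if u: "integrable M u" "\<And>t. u t \<ge> 0" for u
    proof -
      note [measurable] = borel_measurable_integrable[OF u(1)]
      have "(LINT x|D u. indicator B x) = (LINT t|M. (u t / s) *\<^sub>R (indicator B (X t) :: real))"
        unfolding D_def using u s by (subst integral_distr, simp, simp, subst integral_density) auto
      also have "\<dots> = (LINT t|M. (indicator B (X t) * u t) / s)"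
        by (intro Bochner_Integration.integral_cong) auto
      finally show ?thesis by simp
    qed
    have "(LINT t|M. indicator B (X t) * p t) = (LINT t|M. indicator B (X t) * q t)"
      using meas[OF ip] meas[OF iq] eq pq s by simp
    then show ?thesis
      using I1 by (simp add: pq(1) right_diff_distrib)
  qed
qed

text \<open>The real part of the hypothesis mixes Re \<kappa> with Im \<kappa>, so the two cannot be
  separated directly. Conjugating the hypothesis at frequency - w gives it for \<open>cnj\<close>
  \<kappa> as well, and Re \<kappa> and Im \<kappa> are combinations of \<kappa> and its
  conjugate.\<close>

lemma fourier_uniqueness_projection:
  fixes X :: "'a \<Rightarrow> real" and \<kappa> :: "'a \<Rightarrow> complex"
  assumes X[measurable]: "X \<in> borel_measurable M" and \<kappa>: "integrable M \<kappa>"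
    and zero: "\<And>w. (LINT t|M. iexp (w * X t) * \<kappa> t) = 0"
    and B[measurable]: "B \<in> sets borel"
  shows "(LINT t|M. indicator B (X t) * \<kappa> t) = 0"
proof -
  note [measurable] = borel_measurable_integrable[OF \<kappa>]
  have int: "integrable M (\<lambda>t. iexp (w * X t) * \<kappa> t)" for w
    by (rule Bochner_Integration.integrable_bound[OF \<kappa>]) (auto simp: norm_mult)
  have int': "integrable M (\<lambda>t. iexp (w * X t) * cnj (\<kappa> t))" for w
    by (rule Bochner_Integration.integrable_bound[OF \<kappa>]) (auto simp: norm_mult)
  have zero': "(LINT t|M. iexp (w * X t) * cnj (\<kappa> t)) = 0" for w
  proof -
    have "(LINT t|M. iexp (w * X t) * cnj (\<kappa> t)) = (LINT t|M. cnj (iexp ((- w) * X t) * \<kappa> t))"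
      by (simp add: exp_cnj)
    also have "\<dots> = cnj (LINT t|M. iexp ((- w) * X t) * \<kappa> t)"
      by (rule Bochner_Integration.integral_cnj)
    finally show ?thesis
      using zero[of "- w"] by simp
  qed
  have Re0: "(LINT t|M. iexp (w * X t) * complex_of_real (Re (\<kappa> t))) = 0" for w
  proof -
    have "(LINT t|M. iexp (w * X t) * complex_of_real (Re (\<kappa> t)))
        = (LINT t|M. (iexp (w * X t) * \<kappa> t + iexp (w * X t) * cnj (\<kappa> t)) / 2)"
      by (intro Bochner_Integration.integral_cong)
         (auto simp: complex_eq_iff algebra_simps complex_add_cnj)
    then show ?thesis
      using int int' zero zero' by simp
  qed
  have Im0: "(LINT t|M. iexp (w * X t) * complex_of_real (Im (\<kappa> t))) = 0" for w
  proof -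
    have "(LINT t|M. iexp (w * X t) * complex_of_real (Im (\<kappa> t)))
        = (LINT t|M. (iexp (w * X t) * \<kappa> t - iexp (w * X t) * cnj (\<kappa> t)) / (2 * \<i>))"
    proof (intro Bochner_Integration.integral_cong refl)
      fix t
      have *: "iexp (w * X t) * \<kappa> t - iexp (w * X t) * cnj (\<kappa> t)
          = (iexp (w * X t) * complex_of_real (Im (\<kappa> t))) * (2 * \<i>)"
        unfolding right_diff_distrib[symmetric] complex_diff_cnj by simp
      show "iexp (w * X t) * complex_of_real (Im (\<kappa> t))
          = (iexp (w * X t) * \<kappa> t - iexp (w * X t) * cnj (\<kappa> t)) / (2 * \<i>)"
        unfolding * by (rule nonzero_mult_div_cancel_right[symmetric]) simp
    qed
    then show ?thesis
      using int int' zero zero' by simp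
  qed
  have I: "integrable M (\<lambda>t. indicator B (X t) * \<kappa> t)"
    by (rule Bochner_Integration.integrable_bound[OF \<kappa>]) (auto simp: norm_mult indicator_def)
  have "(LINT t|M. Re (indicator B (X t) * \<kappa> t)) = (LINT t|M. indicator B (X t) * Re (\<kappa> t))"
    by (intro Bochner_Integration.integral_cong) (auto simp: indicator_def)
  moreover have "(LINT t|M. Im (indicator B (X t) * \<kappa> t)) = (LINT t|M. indicator B (X t) * Im (\<kappa> t))"
    by (intro Bochner_Integration.integral_cong) (auto simp: indicator_def)
  ultimately show ?thesis
    unfolding integral_Re[OF I] integral_Im[OF I]
    using real_fourier_uniqueness_projection[OF X _ Re0 B] real_fourier_uniqueness_projection[OF X _ Im0 B]
      \<kappa> by (simp add: complex_eq_iff)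
qed

text \<open>Dynkin's argument: boxes generate the Borel sets and are stable under intersection. The
  total integral is assumed separately for the complement step, since the whole space is not a
  box.\<close>

lemma AE_zero_if_box_integrals_zero:
  fixes k :: "'a::euclidean_space \<Rightarrow> complex"
  assumes k: "integrable lborel k" and tot: "integral\<^sup>L lborel k = 0"
    and box: "\<And>u v. (LINT t|lborel. indicator (box u v) t * k t) = 0"
  shows "AE t in lborel. k t = 0"
proof -
  note [measurable] = borel_measurable_integrable[OF k]
  have int: "integrable lborel (\<lambda>t. indicator A t * k t)" if [measurable]: "A \<in> sets borel" for A
    by (rule Bochner_Integration.integrable_bound[OF k]) (auto simp: norm_mult indicator_def)
  have sets: "sets (borel :: 'a measure) = sigma_sets UNIV (range (\<lambda>(a, b). box a b))"
    by (subst borel_eq_box) (simp add: sets_measure_of)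
  have stable: "Int_stable (range (\<lambda>(a, b). box a b :: 'a set))"
    unfolding Int_stable_def by (auto simp: box_Int_box)
  have subset_Pow: "range (\<lambda>(a, b). box a b :: 'a set) \<subseteq> Pow UNIV"
    by simp
  have zero: "(LINT t|lborel. indicator A t * k t) = 0" if A: "A \<in> sets borel" for A
    using stable subset_Pow A[unfolded sets]
  proof (induction rule: sigma_sets_induct_disjoint)
    case (basic A)
    then show ?case using box by auto
  next
    case empty
    show ?case by simp
  next
    case (compl A)
    then have [measurable]: "A \<in> sets borel" by (simp add: sets)
    have "(LINT t|lborel. indicator (UNIV - A) t * k t) = (LINT t|lborel. k t - indicator A t * k t)"
      by (intro Bochner_Integration.integral_cong) (auto simp: indicator_def)
    then show ?case
      using compl k int[of A] tot by simp
  next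
    case (union A)
    then have [measurable]: "\<And>i. A i \<in> sets borel" by (auto simp: sets)
    have "(\<lambda>i. LINT t|lborel. indicator (\<Union>j<i. A j) t * k t)
        \<longlonglongrightarrow> (LINT t|lborel. indicator (\<Union>i. A i) t * k t)"
    proof (rule integral_dominated_convergence[where w="\<lambda>t. norm (k t)"])
      show "AE t in lborel. (\<lambda>i. indicator (\<Union>j<i. A j) t * k t) \<longlonglongrightarrow> indicator (\<Union>i. A i) t * k t"
      proof (rule AE_I2)
        fix t :: 'a
        have "(\<lambda>i. indicator (\<Union>j<i. A j) t :: complex) \<longlonglongrightarrow> indicator (\<Union>i. A i) t"
          by (rule LIMSEQ_indicator_UN)
        then show "(\<lambda>i. indicator (\<Union>j<i. A j) t * k t) \<longlonglongrightarrow> indicator (\<Union>i. A i) t * k t"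
          by (intro tendsto_intros)
      qed
    qed (use k in \<open>auto simp: indicator_def\<close>)
    moreover have "(LINT t|lborel. indicator (\<Union>j<i. A j) t * k t) = 0" for i
    proof -
      have "(LINT t|lborel. indicator (\<Union>j<i. A j) t * k t)
          = (LINT t|lborel. (\<Sum>j<i. indicator (A j) t * k t))"
      proof (intro Bochner_Integration.integral_cong refl)
        fix t
        have "indicator (\<Union>j<i. A j) t = (\<Sum>j<i. indicator (A j) t :: complex)"
          using union(1) by (intro indicator_UN_disjoint) (auto simp: disjoint_family_on_def)
        then show "indicator (\<Union>j<i. A j) t * k t = (\<Sum>j<i. indicator (A j) t * k t)"
          by (simp add: sum_distrib_right)
      qed
      also have "\<dots> = (\<Sum>j<i. LINT t|lborel. indicator (A j) t * k t)"
        by (intro Bochner_Integration.integral_sum int) auto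
      finally show ?thesis using union by simp
    qed
    ultimately show ?case
      by (simp add: LIMSEQ_const_iff)
  qed
  \<comment> \<open>One-sided: testing on the set where \<open>u\<close> is positive. Applying it to
    plus and minus the real and imaginary parts gives equality.\<close>
  have real_zero: "AE t in lborel. u t \<le> 0"
    if u: "integrable lborel u" and z: "\<And>A. A \<in> sets borel \<Longrightarrow> (LINT t|lborel. indicator A t * u t) = 0"
    for u :: "'a \<Rightarrow> real"
  proof -
    note [measurable] = borel_measurable_integrable[OF u]
    let ?A = "{t. u t > 0}"
    have A: "?A \<in> sets borel" by measurable
    have "integrable lborel (\<lambda>t. indicator ?A t * u t)"
      by (rule Bochner_Integration.integrable_bound[OF u]) (use A in \<open>auto simp: indicator_def\<close>)
    then have "AE t in lborel. indicator ?A t * u t = 0"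
      using z[OF A] by (subst integral_nonneg_eq_0_iff_AE[symmetric]) (auto simp: indicator_def)
    then show ?thesis
      by eventually_elim (auto simp: indicator_def split: if_splits)
  qed
  have ReIm: "(LINT t|lborel. indicator A t * Re (k t)) = 0" "(LINT t|lborel. indicator A t * Im (k t)) = 0"
    if A: "A \<in> sets borel" for A
  proof -
    have "(LINT t|lborel. indicator A t * Re (k t)) = (LINT t|lborel. Re (indicator A t * k t))"
      by (intro Bochner_Integration.integral_cong) (auto simp: indicator_def)
    also have "\<dots> = Re (LINT t|lborel. indicator A t * k t)"
      by (rule integral_Re[OF int[OF A]])
    finally show "(LINT t|lborel. indicator A t * Re (k t)) = 0"
      using zero[OF A] by simp
    have "(LINT t|lborel. indicator A t * Im (k t)) = (LINT t|lborel. Im (indicator A t * k t))"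
      by (intro Bochner_Integration.integral_cong) (auto simp: indicator_def)
    also have "\<dots> = Im (LINT t|lborel. indicator A t * k t)"
      by (rule integral_Im[OF int[OF A]])
    finally show "(LINT t|lborel. indicator A t * Im (k t)) = 0"
      using zero[OF A] by simp
  qed
  have "AE t in lborel. Re (k t) \<le> 0" "AE t in lborel. - Re (k t) \<le> 0"
    "AE t in lborel. Im (k t) \<le> 0" "AE t in lborel. - Im (k t) \<le> 0"
    by (rule real_zero; use k ReIm in simp)+
  then show ?thesis
    by eventually_elim (simp add: complex_eq_iff)
qed

text \<open>Reduces to one dimension by trading exponential factors for indicators of Borel sets,
  one coordinate at a time. When no exponential is left, the integrals are those over boxes.\<close>

lemma fourier_uniqueness:
  fixes k :: "'a::euclidean_space \<Rightarrow> complex"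
  assumes k: "integrable lborel k"
    and zero: "\<And>w. (LINT t|lborel. exp (\<i> * complex_of_real (t \<bullet> w)) * k t) = 0"
  shows "AE t in lborel. k t = 0"
proof -
  note [measurable] = borel_measurable_integrable[OF k]
  \<comment> \<open>The coordinates in \<open>S\<close> are already localised to the sets
    \<open>B b\<close>; the others still carry arbitrary frequencies \<open>w b\<close>. The
    induction needs all \<open>w\<close> at once.\<close>
  have part: "(LINT t|lborel. (\<Prod>b\<in>S. indicator (B b) (t \<bullet> b))
      * exp (\<i> * complex_of_real (\<Sum>b\<in>Basis - S. w b * (t \<bullet> b))) * k t) = 0"
    if "S \<subseteq> Basis" and [measurable]: "\<And>b. B b \<in> sets borel"
    for S :: "'a set" and B :: "'a \<Rightarrow> real set" and w :: "'a \<Rightarrow> real"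
    using finite_subset[OF that(1) finite_Basis] that(1)
  proof (induction S arbitrary: w rule: finite_induct)
    case empty
    have "t \<bullet> (\<Sum>b\<in>Basis. w b *\<^sub>R b) = (\<Sum>b\<in>Basis. w b * (t \<bullet> b))" for t
      by (simp add: inner_sum_right)
    then show ?case
      using zero[of "\<Sum>b\<in>Basis. w b *\<^sub>R b"] by simp
  next
    case (insert c S)
    define \<kappa> where "\<kappa> = (\<lambda>t. (\<Prod>b\<in>S. indicator (B b) (t \<bullet> b))
      * exp (\<i> * complex_of_real (\<Sum>b\<in>Basis - insert c S. w b * (t \<bullet> b))) * k t)"
    have nP: "norm (\<Prod>b\<in>S. indicator (B b) (t \<bullet> b) :: complex) \<le> 1" for t
      unfolding prod_norm[symmetric] by (intro prod_le_1) (auto simp: indicator_def)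
    have int: "integrable lborel \<kappa>"
      unfolding \<kappa>_def
      by (rule Bochner_Integration.integrable_bound[OF k])
         (auto simp: norm_mult intro!: mult_left_le_one_le nP)
    have "(LINT t|lborel. indicator (B c) (t \<bullet> c) * \<kappa> t) = 0"
    proof (rule fourier_uniqueness_projection[OF _ int])
      fix r :: real
      \<comment> \<open>The one-dimensional frequency \<open>r\<close> is put back as the entry of
        \<open>w\<close> at \<open>c\<close>, so the induction hypothesis for the updated
        \<open>w\<close> says that the projected transform vanishes.\<close>
      have "(\<Sum>b\<in>Basis - S. (w(c := r)) b * (t \<bullet> b))
          = r * (t \<bullet> c) + (\<Sum>b\<in>Basis - insert c S. w b * (t \<bullet> b))" for t
      proof -
        have "(\<Sum>b\<in>Basis - S. (w(c := r)) b * (t \<bullet> b))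
          = r * (t \<bullet> c) + (\<Sum>b\<in>(Basis - S) - {c}. (w(c := r)) b * (t \<bullet> b))"
          using insert by (subst sum.remove[of _ c]) auto
        also have "(Basis - S) - {c} = Basis - insert c S" by auto
        finally show ?thesis by simp
      qed
      then have "(LINT t|lborel. iexp (r * (t \<bullet> c)) * \<kappa> t) = (LINT t|lborel. (\<Prod>b\<in>S. indicator (B b) (t \<bullet> b))
        * exp (\<i> * complex_of_real (\<Sum>b\<in>Basis - S. (w(c := r)) b * (t \<bullet> b))) * k t)"
        unfolding \<kappa>_def
        by (intro Bochner_Integration.integral_cong) (simp_all add: exp_add distrib_left ac_simps)
      then show "(LINT t|lborel. iexp (r * (t \<bullet> c)) * \<kappa> t) = 0"
        using insert by simp
    qed auto
    then show ?case
      unfolding \<kappa>_def using insert by (simp add: ac_simps)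
  qed
  show ?thesis
  proof (rule AE_zero_if_box_integrals_zero[OF k])
    show "integral\<^sup>L lborel k = 0"
      using zero[of 0] by simp
  next
    fix u v :: 'a
    have "indicator (box u v) t = (\<Prod>b\<in>Basis. indicator {u \<bullet> b<..<v \<bullet> b} (t \<bullet> b) :: complex)" for t
      by (auto simp: indicator_def box_def)
    then show "(LINT t|lborel. indicator (box u v) t * k t) = 0"
      using part[of Basis "\<lambda>b. {u \<bullet> b<..<v \<bullet> b}"] by simp
  qed
qed

section \<open>Zeros and parametric integrals of entire functions\<close>

text \<open>Each further zero is a zero of the previous cofactor, because the product already split
  off does not vanish there; the difference quotient, completed by the derivative, removes
  it.\<close>

lemma entire_divide_zeros:
  fixes g :: "complex \<Rightarrow> complex"
  assumes "finite Z" "g holomorphic_on UNIV" "\<And>a. a \<in> Z \<Longrightarrow> g a = 0"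
  shows "\<exists>q. q holomorphic_on UNIV \<and> (\<forall>z. g z = (\<Prod>a\<in>Z. z - a) * q z)"
  using assms
proof (induction Z rule: finite_induct)
  case empty
  then show ?case by auto
next
  case (insert a Z)
  then obtain q where q: "q holomorphic_on UNIV" "\<And>z. g z = (\<Prod>a\<in>Z. z - a) * q z"
    by auto
  have "(\<Prod>c\<in>Z. a - c) \<noteq> 0"
    using insert by auto
  with q(2)[of a] insert have qa: "q a = 0"
    by simp
  define q' where "q' = (\<lambda>z. if z = a then deriv q a else (q z - q a) / (z - a))"
  have "q' holomorphic_on UNIV"
    unfolding q'_def by (rule pole_lemma_open[OF q(1)]) auto
  moreover have "q z = (z - a) * q' z" for z
    by (auto simp: q'_def qa)
  ultimately show ?case
    using q insert by (intro exI[of _ q']) (auto simp: ac_simps)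
qed

text \<open>The origin is itself a lattice point, so \<open>F\<close> may vanish there;
  \<open>q 0\<close> is the first nonzero Taylor coefficient, the quantity to be bounded. The local
  factorisation at 0 and the global quotient off 0 agree and glue to an entire function.\<close>

lemma entire_divide_order:
  fixes F :: "complex \<Rightarrow> complex"
  assumes "F holomorphic_on UNIV" "F w \<noteq> 0"
  shows "\<exists>p q. q holomorphic_on UNIV \<and> q 0 \<noteq> 0 \<and> (\<forall>z. F z = z ^ p * q z)"
proof (cases "F 0 = 0")
  case False
  then show ?thesis
    using assms by (intro exI[of _ 0] exI[of _ F]) auto
next
  case True
  obtain g r n where n: "0 < n" "0 < r" and hol: "g holomorphic_on ball 0 r"
    and g: "\<And>w. w \<in> ball 0 r \<Longrightarrow> F w = (w - 0)^n * g w" "\<And>w. w \<in> ball 0 r \<Longrightarrow> g w \<noteq> 0"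
  proof (rule holomorphic_factor_zero_nonconstant[OF assms(1), of 0])
    show "\<not> F constant_on UNIV"
      using True assms(2) unfolding constant_on_def by (metis UNIV_I)
  qed (use True in auto)
  define q where "q = (\<lambda>z. if z = 0 then g 0 else F z / z ^ n)"
  have eq: "q z = g z" if "z \<in> ball 0 r" for z
    using g(1)[OF that] by (auto simp: q_def)
  have "q holomorphic_on ball 0 r"
    using hol eq by (metis holomorphic_transform)
  moreover have "q holomorphic_on (- {0})"
  proof (rule holomorphic_transform[of "\<lambda>z. F z / z ^ n"])
    show "(\<lambda>z. F z / z ^ n) holomorphic_on - {0}"
      by (intro holomorphic_intros holomorphic_on_subset[OF assms(1)]) auto
  qed (auto simp: q_def)
  ultimately have "q holomorphic_on (ball 0 r \<union> - {0})"
    by (intro holomorphic_on_Un) auto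
  also have "ball 0 r \<union> - {0} = (UNIV :: complex set)"
    using n by auto
  finally have "q holomorphic_on UNIV" .
  moreover have "F z = z ^ n * q z" for z
    using True n by (auto simp: q_def)
  moreover have "q 0 \<noteq> 0"
    using g(2)[of 0] n by (simp add: q_def)
  ultimately show ?thesis by blast
qed

text \<open>
  Dividing out the zeros \<open>\<plusminus>\<tau>\<surd>1, \<dots>, \<plusminus>\<tau>\<surd>N\<close> and applying the maximum principle on the
  circle of radius \<open>\<tau>\<surd>L\<close> bounds the first nonzero Taylor coefficient by
  \<open>exp (\<sigma> \<tau>\<^sup>2 L)\<close> divided by a binomial coefficient; \<open>L \<approx> e N\<close> makes this tend to zero.
\<close>

lemma entire_zero_on_sqrt_lattice:
  fixes F :: "complex \<Rightarrow> complex"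
  assumes hol: "F holomorphic_on UNIV"
    and growth: "\<And>z. norm (F z) \<le> C * exp (\<sigma> * (norm z)\<^sup>2)"
    and \<tau>: "\<tau> > 0" "\<sigma> \<ge> 0" "\<sigma> * \<tau>\<^sup>2 * exp 1 < 1"
    and zeros: "\<And>r. r \<in> sqrt_ints \<Longrightarrow> F (complex_of_real (\<tau> * r)) = 0"
  shows "F z = 0"
proof (rule ccontr)
  assume "F z \<noteq> 0"
  then obtain p q where q: "q holomorphic_on UNIV" "q 0 \<noteq> 0" "\<And>z. F z = z ^ p * q z"
    using entire_divide_order[OF hol] by blast
  define s where "s = (\<lambda>k::nat. complex_of_real (\<tau> * sqrt (real k)))"
  have s2: "(s k)\<^sup>2 = of_real (\<tau>\<^sup>2 * real k)" for k
    by (simp add: s_def power_mult_distrib flip: of_real_power)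
  have s0: "s k \<noteq> 0" if "k \<ge> 1" for k
    using that \<tau> by (simp add: s_def)
  have s_inj: "s k = s l \<longleftrightarrow> k = l" for k l
    using \<tau> by (simp add: s_def)
  have s_neg: "s k \<noteq> - s l" if "k \<ge> 1" for k l
  proof -
    have "\<tau> * sqrt k > 0" "\<tau> * sqrt l \<ge> 0" using that \<tau> by auto
    then have "\<tau> * sqrt k \<noteq> - (\<tau> * sqrt l)" by linarith
    then show ?thesis unfolding s_def of_real_minus[symmetric] of_real_eq_iff .
  qed
  have qs: "q (s k) = 0" "q (- s k) = 0" if "k \<ge> 1" for k
  proof -
    have "F (s k) = 0" unfolding s_def
      by (rule zeros) (force simp: sqrt_ints_def)
    then show "q (s k) = 0" using q(3)[of "s k"] s0[OF that] by simp
    have "F (complex_of_real (\<tau> * (- sqrt (real k)))) = 0"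
      by (rule zeros) (force simp: sqrt_ints_def)
    then have "F (- s k) = 0" by (simp add: s_def)
    then show "q (- s k) = 0" using q(3)[of "- s k"] s0[OF that] by simp
  qed
  have C: "C \<ge> 0"
    using order_trans[OF norm_ge_zero growth[of 0]] by simp
  \<comment> \<open>\<open>N < L\<close> puts the zeros to be divided out strictly inside the circle
    of squared radius \<tau>^2 L. The second condition makes this radius at least 1, so the factor
    \<open>z ^ p\<close> has modulus at least 1 on the circle and \<open>q\<close> inherits the
    bound for \<open>F\<close>.\<close>
  have key: "norm (q 0) * real ((L - 1) choose N) \<le> C * exp (\<sigma> * \<tau>\<^sup>2 * L)"
    if L: "N < L" "\<tau>\<^sup>2 * L \<ge> 1" for N L :: nat
  proof -
    define Z where "Z = s ` {1..N} \<union> (\<lambda>k. - s k) ` {1..N}"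
    obtain g where g: "g holomorphic_on UNIV" "\<And>z. q z = (\<Prod>a\<in>Z. z - a) * g z"
    proof -
      have "finite Z" "\<And>a. a \<in> Z \<Longrightarrow> q a = 0"
        using qs by (auto simp: Z_def)
      then show ?thesis
        using entire_divide_zeros[OF _ q(1), of Z] that by blast
    qed
    have Z: "(\<Prod>a\<in>Z. z - a) = (\<Prod>k=1..N. z\<^sup>2 - of_real (\<tau>\<^sup>2 * real k))" for z
    proof -
      have "(\<Prod>a\<in>Z. z - a) = (\<Prod>a\<in>s ` {1..N}. z - a) * (\<Prod>a\<in>(\<lambda>k. - s k) ` {1..N}. z - a)"
        unfolding Z_def by (intro prod.union_disjoint) (use s_neg in auto)
      also have "(\<Prod>a\<in>s ` {1..N}. z - a) = (\<Prod>k=1..N. z - s k)"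
        by (subst prod.reindex) (auto simp: inj_on_def s_inj)
      also have "(\<Prod>a\<in>(\<lambda>k. - s k) ` {1..N}. z - a) = (\<Prod>k=1..N. z + s k)"
        by (subst prod.reindex) (auto simp: inj_on_def s_inj)
      finally show ?thesis
        unfolding prod.distrib[symmetric] s2[symmetric]
        by (simp add: power2_eq_square algebra_simps)
    qed
    define R where "R = \<tau> * sqrt (real L)"
    have R: "R \<ge> 1" "R\<^sup>2 = \<tau>\<^sup>2 * L"
    proof -
      show "R\<^sup>2 = \<tau>\<^sup>2 * L" by (simp add: R_def power_mult_distrib)
      then have "R\<^sup>2 \<ge> 1" using L by simp
      moreover have "R \<ge> 0" using \<tau> by (simp add: R_def)
      ultimately show "R \<ge> 1"
        by (metis one_power2 power2_le_imp_le)
    qed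
    \<comment> \<open>Lower bound for the product of the factors w^2 - \<tau>^2 k on the circle, by
      the reverse triangle inequality. \<open>Q\<close> below is the modulus of the same product at
      0.\<close>
    define P where "P = (\<Prod>k=1..N. \<tau>\<^sup>2 * (real L - real k))"
    have P: "P > 0"
      unfolding P_def using L \<tau> by (intro prod_pos) auto
    have bd: "norm (g w) \<le> C * exp (\<sigma> * \<tau>\<^sup>2 * L) / P" if w: "norm (0 - w) = R" for w
    proof -
      have "P \<le> (\<Prod>k=1..N. norm (w\<^sup>2 - of_real (\<tau>\<^sup>2 * real k)))"
        unfolding P_def
      proof (rule prod_mono, safe)
        fix k assume k: "k \<in> {1..N}"
        show "0 \<le> \<tau>\<^sup>2 * (real L - real k)" using k L by auto
        have "\<tau>\<^sup>2 * (real L - real k) = norm (w\<^sup>2) - norm (complex_of_real (\<tau>\<^sup>2 * real k))"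
          using w R by (simp add: norm_power norm_mult algebra_simps)
        also have "\<dots> \<le> norm (w\<^sup>2 - of_real (\<tau>\<^sup>2 * real k))"
          by (rule norm_triangle_ineq2)
        finally show "\<tau>\<^sup>2 * (real L - real k) \<le> norm (w\<^sup>2 - of_real (\<tau>\<^sup>2 * real k))" .
      qed
      then have "P * norm (g w) \<le> norm (q w)"
        unfolding g(2)[of w] Z norm_mult prod_norm[symmetric] by (intro mult_right_mono) auto
      also have "\<dots> \<le> R ^ p * norm (q w)"
        using mult_right_mono[OF one_le_power[OF R(1), of p] norm_ge_zero[of "q w"]] by simp
      also have "\<dots> = norm (F w)"
        using w by (simp add: q(3) norm_mult norm_power)
      also have "\<dots> \<le> C * exp (\<sigma> * \<tau>\<^sup>2 * L)"
        using growth[of w] w R by (simp add: ac_simps)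
      finally show ?thesis
        using P by (simp add: field_simps)
    qed
    \<comment> \<open>Cauchy's inequality for the derivative of order 0 serves as the maximum
      principle at the centre.\<close>
    have "norm ((deriv ^^ 0) g 0) \<le> fact 0 * (C * exp (\<sigma> * \<tau>\<^sup>2 * L) / P) / R ^ 0"
      using R bd holomorphic_on_imp_continuous_on[OF g(1)]
      by (intro Cauchy_inequality) 
         (auto intro: holomorphic_on_subset[OF g(1)] continuous_on_subset)
    then have g0: "norm (g 0) \<le> C * exp (\<sigma> * \<tau>\<^sup>2 * L) / P" by simp
    define Q where "Q = (\<Prod>k=1..N. \<tau>\<^sup>2 * real k)"
    have Q: "Q > 0"
      unfolding Q_def using \<tau> by (intro prod_pos) auto
    have "norm (q 0) = Q * norm (g 0)"
      unfolding g(2)[of 0] Z norm_mult prod_norm[symmetric] Q_def by (simp add: norm_mult norm_power)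
    also have "\<dots> \<le> Q * (C * exp (\<sigma> * \<tau>\<^sup>2 * L) / P)"
      using g0 Q by (intro mult_left_mono) auto
    finally have 1: "norm (q 0) * (P / Q) \<le> C * exp (\<sigma> * \<tau>\<^sup>2 * L)"
      using P Q by (simp add: field_simps)
    \<comment> \<open>The powers of \<tau> cancel; what remains is (L-1) (L-2) ... (L-N) / N!, the
      binomial coefficient.\<close>
    have "P / Q = (\<Prod>k=1..N. (real L - real k) / real k)"
      unfolding P_def Q_def prod_dividef[symmetric] using \<tau> by (intro prod.cong) auto
    also have "\<dots> = (real (L - 1) gchoose N)"
      using L(1)
    proof (induction N)
      case (Suc N)
      have "(real L - real (Suc N)) / real (Suc N) * (real (L - 1) gchoose N)
          = (real (L - 1) gchoose Suc N)"
        using gbinomial_mult_1[of "real (L - 1)" N] Suc.prems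
        by (simp add: field_simps of_nat_diff)
      then show ?case
        using Suc by (simp add: ac_simps)
    qed simp
    also have "\<dots> = real ((L - 1) choose N)"
      by (simp add: binomial_gbinomial)
    finally show ?thesis using 1 by simp
  qed
  define \<theta> where "\<theta> = \<sigma> * \<tau>\<^sup>2 * exp 1"
  have \<theta>: "0 \<le> \<theta>" "\<theta> < 1" using \<tau> by (auto simp: \<theta>_def)
  define M where "M = C * exp (3 * \<theta>)"
  have st: "\<sigma> * \<tau>\<^sup>2 \<le> \<theta>" 
    using \<tau> mult_left_mono[of 1 "exp 1" "\<sigma> * \<tau>\<^sup>2"] by (simp add: \<theta>_def)
  have ev: "eventually (\<lambda>N. norm (q 0) \<le> M * exp (- (1 - \<theta>) * real N)) sequentially"
    using eventually_ge_at_top[of "nat \<lceil>1 / \<tau>\<^sup>2\<rceil> + 1"]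
  proof eventually_elim
    case (elim N)
    \<comment> \<open>The added 1 keeps \<open>L - 1\<close> at least e N, so the binomial
      coefficient is at least ((L-1) / N)^N, hence at least e^N. Rounding makes \<open>L\<close>
      exceed e N by at most 2; the constant factor \<open>exp (3 * \<theta>)\<close> absorbs
      this.\<close>
    define L where "L = nat \<lceil>exp 1 * real N\<rceil> + 1"
    have e1: "exp 1 \<ge> (1::real)" by simp
    have L1: "real (L - 1) \<ge> exp 1 * real N" "real L \<le> exp 1 * real N + 2"
      using mult_nonneg_nonneg[OF exp_ge_zero of_nat_0_le_iff, of 1 N] unfolding L_def by linarith+
    have N1: "real N \<ge> 1" "real N \<ge> 1 / \<tau>\<^sup>2" using elim by linarith+
    have "real N \<le> exp 1 * real N" using N1 e1 by simp
    then have NL: "N \<le> L - 1" "N < L" using L1 by (auto simp: L_def) linarith+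
    have "\<tau>\<^sup>2 * real N \<ge> 1" using N1 \<tau> by (simp add: field_simps)
    moreover have "\<tau>\<^sup>2 * real N \<le> \<tau>\<^sup>2 * real L" using NL by (intro mult_left_mono) auto
    ultimately have tL: "\<tau>\<^sup>2 * L \<ge> 1" by linarith
    have "exp (real N) = exp 1 ^ N" by (simp add: exp_of_nat_mult[symmetric])
    also have "\<dots> \<le> (real (L - 1) / real N) ^ N"
      using L1 N1 by (intro power_mono) (auto simp: field_simps)
    also have "\<dots> \<le> real ((L - 1) choose N)"
      by (rule binomial_ge_n_over_k_pow_k) fact
    finally have "norm (q 0) * exp (real N) \<le> norm (q 0) * real ((L - 1) choose N)"
      by (intro mult_left_mono) auto
    also have "\<dots> \<le> C * exp (\<sigma> * \<tau>\<^sup>2 * L)"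
      by (rule key[OF NL(2) tL])
    also have "\<dots> \<le> C * exp (3 * \<theta> + \<theta> * N)"
    proof -
      have "\<sigma> * \<tau>\<^sup>2 * L \<le> \<sigma> * \<tau>\<^sup>2 * (exp 1 * real N + 2)"
        using L1 \<tau> by (intro mult_left_mono) auto
      also have "\<dots> = \<theta> * N + 2 * (\<sigma> * \<tau>\<^sup>2)" by (simp add: \<theta>_def algebra_simps)
      also have "\<dots> \<le> 3 * \<theta> + \<theta> * N" using st \<theta> by linarith
      finally show ?thesis using C by (intro mult_left_mono) auto
    qed
    finally have "norm (q 0) \<le> C * exp (3 * \<theta> + \<theta> * N) / exp (real N)"
      by (simp add: pos_le_divide_eq)
    also have "\<dots> = M * exp (- (1 - \<theta>) * real N)"
      by (simp add: M_def exp_diff[symmetric] exp_add[symmetric] algebra_simps exp_minus field_simps)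
    finally show ?case .
  qed
  have "(\<lambda>N. M * exp (- (1 - \<theta>) * real N)) \<longlonglongrightarrow> M * 0"
    using \<theta> by (intro tendsto_intros) real_asymp
  then have "norm (q 0) \<le> M * 0"
    by (rule tendsto_lowerbound[OF _ ev]) simp
  then show False using q(2) by simp
qed

text \<open>Domination of the functions themselves is enough: Cauchy's inequality turns it into
  domination of the derivatives, hence of the difference quotients, and dominated convergence
  applies.\<close>

lemma holomorphic_parametric_integral:
  fixes g :: "complex \<Rightarrow> 'a \<Rightarrow> complex"
  assumes hol: "\<And>t. (\<lambda>z. g z t) holomorphic_on UNIV"
    and meas: "\<And>z. g z \<in> borel_measurable M"
    and dom: "\<And>R. \<exists>w. integrable M w \<and> (\<forall>z t. norm z \<le> R \<longrightarrow> norm (g z t) \<le> w t)"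
  shows "(\<lambda>z. LINT t|M. g z t) holomorphic_on UNIV"
proof -
  have [measurable]: "g z \<in> borel_measurable M" for z by (rule meas)
  have "((\<lambda>z. LINT t|M. g z t) has_field_derivative (LINT t|M. deriv (\<lambda>z. g z t) z0)) (at z0)" for z0
  proof -
    \<comment> \<open>One unit of the margin 2 lets \<open>z\<close> move around \<open>z0\<close>,
      the other is the radius of the Cauchy circle around \<open>z\<close>.\<close>
    obtain w where w: "integrable M w" "\<And>z t. norm z \<le> norm z0 + 2 \<Longrightarrow> norm (g z t) \<le> w t"
      using dom[of "norm z0 + 2"] by blast
    have int: "integrable M (g z)" if "norm z \<le> norm z0 + 2" for z
      by (rule Bochner_Integration.integrable_bound[OF w(1)])
         (use w(2)[OF that] in \<open>auto intro: order_trans[OF _ abs_ge_self]\<close>)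
    have dz: "((\<lambda>z. g z t) has_field_derivative deriv (\<lambda>z. g z t) z) (at z)" for z t
      using holomorphic_derivI[OF hol[of t], of z] by simp
    have cauchy: "norm (deriv (\<lambda>z. g z t) z) \<le> w t" if z: "norm (z - z0) \<le> 1" for z t
    proof -
      have "norm ((deriv ^^ 1) (\<lambda>z. g z t) z) \<le> fact 1 * w t / 1 ^ 1"
      proof (rule Cauchy_inequality)
        show "continuous_on (cball z 1) (\<lambda>z. g z t)"
          using holomorphic_on_imp_continuous_on[OF hol] continuous_on_subset by blast
        fix x assume "norm (z - x) = 1"
        then show "norm (g x t) \<le> w t"
          using z norm_triangle_ineq[of "x - z" z] norm_triangle_ineq[of "z - z0" z0]
          by (intro w) (auto simp: norm_minus_commute)
      qed (auto intro: holomorphic_on_subset[OF hol])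
      then show ?thesis by simp
    qed
    have lip: "norm (g z t - g z0 t) \<le> w t * norm (z - z0)" if "norm (z - z0) \<le> 1" for z t
      using field_differentiable_bound[of "cball z0 1" "\<lambda>z. g z t" "\<lambda>z. deriv (\<lambda>z. g z t) z" "w t" z0 z] that cauchy
      by (auto simp: dist_norm norm_minus_commute intro: has_field_derivative_at_within dz)
    have "((\<lambda>z. ((LINT t|M. g z t) - (LINT t|M. g z0 t)) / (z - z0)) \<longlongrightarrow> (LINT t|M. deriv (\<lambda>z. g z t) z0)) (at z0)"
      unfolding tendsto_at_iff_sequentially comp_def
    proof safe
      fix X :: "nat \<Rightarrow> complex"
      assume X: "\<forall>i. X i \<in> UNIV - {z0}" "X \<longlonglongrightarrow> z0"
      have "eventually (\<lambda>i. norm (X i - z0) < 1) sequentially"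
        using X(2) unfolding tendsto_iff dist_norm by simp
      then obtain i0 where i0: "\<And>i. i \<ge> i0 \<Longrightarrow> norm (X i - z0) < 1"
        by (auto simp: eventually_sequentially)
      \<comment> \<open>Dropping finitely many terms puts the whole sequence in the unit disc around
        \<open>z0\<close>, where the Lipschitz bound holds.\<close>
      define Y where "Y = (\<lambda>i. X (i + i0))"
      have Y: "Y \<longlonglongrightarrow> z0" "\<And>i. Y i \<noteq> z0" "\<And>i. norm (Y i - z0) \<le> 1"
        using X i0 unfolding Y_def by (auto intro: LIMSEQ_ignore_initial_segment less_imp_le)
      have Yint: "integrable M (g (Y i))" for i
        using Y(3)[of i] norm_triangle_ineq[of "Y i - z0" z0] by (intro int) auto
      have "(\<lambda>i. LINT t|M. (g (Y i) t - g z0 t) / (Y i - z0)) \<longlonglongrightarrow> (LINT t|M. deriv (\<lambda>z. g z t) z0)"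
      proof (rule integral_dominated_convergence[where w=w])
        have lim: "(\<lambda>i. (g (Y i) t - g z0 t) / (Y i - z0)) \<longlonglongrightarrow> deriv (\<lambda>z. g z t) z0" for t
        proof -
          have "((\<lambda>z. (g z t - g z0 t) / (z - z0)) \<longlongrightarrow> deriv (\<lambda>z. g z t) z0) (at z0)"
            using dz[of t z0] by (simp add: has_field_derivative_iff)
          then show ?thesis
            unfolding tendsto_at_iff_sequentially comp_def using Y by auto
        qed
        then show "AE t in M. (\<lambda>i. (g (Y i) t - g z0 t) / (Y i - z0)) \<longlonglongrightarrow> deriv (\<lambda>z. g z t) z0"
          by simp
        \<comment> \<open>The derivative is measurable in \<open>t\<close> as a pointwise limit of
          difference quotients.\<close>
        show "(\<lambda>t. deriv (\<lambda>z. g z t) z0) \<in> borel_measurable M"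
          by (rule borel_measurable_LIMSEQ_metric[OF _ lim]) measurable
        show "AE t in M. norm ((g (Y i) t - g z0 t) / (Y i - z0)) \<le> w t" for i
          using lip[OF Y(3)[of i]] Y(2)[of i] by (auto simp: norm_divide field_simps)
      qed (use w in auto)
      also have "(\<lambda>i. LINT t|M. (g (Y i) t - g z0 t) / (Y i - z0))
          = (\<lambda>i. ((LINT t|M. g (Y i) t) - (LINT t|M. g z0 t)) / (Y i - z0))"
        using Yint int[of z0] by simp
      finally have "(\<lambda>i. ((LINT t|M. g (X (i + i0)) t) - (LINT t|M. g z0 t)) / (X (i + i0) - z0))
          \<longlonglongrightarrow> (LINT t|M. deriv (\<lambda>z. g z t) z0)"
        unfolding Y_def by simp
      then show "(\<lambda>i. ((LINT t|M. g (X i) t) - (LINT t|M. g z0 t)) / (X i - z0))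
          \<longlonglongrightarrow> (LINT t|M. deriv (\<lambda>z. g z t) z0)"
        by (rule LIMSEQ_offset)
    qed
    then show ?thesis
      by (simp add: has_field_derivative_iff)
  qed
  then show ?thesis
    unfolding holomorphic_on_open[OF open_UNIV] by blast
qed

section \<open>Convolution and phase retrieval from all samples\<close>

lemma lborel_distr_affine:
  fixes t :: "'a::euclidean_space"
  assumes "c = 1 \<or> c = -1"
  shows "distr lborel borel (\<lambda>x. t + c *\<^sub>R x) = (lborel :: 'a measure)"
proof -
  have "(lborel :: 'a measure) = density (distr lborel borel (\<lambda>x. t + c *\<^sub>R x)) (\<lambda>_. 1)"
    using lborel_affine[of c t] assms by auto
  then show ?thesis
    by (simp add: density_1)
qed

lemma lborel_distr_translate: "distr lborel borel (\<lambda>x. x - t) = (lborel :: 'a::euclidean_space measure)"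
  using lborel_distr_affine[of 1 "- t"] by simp

lemma lborel_distr_reflect: "distr lborel borel (\<lambda>x. t - x) = (lborel :: 'a::euclidean_space measure)"
  using lborel_distr_affine[of "-1" t] by simp

lemma
  fixes k :: "'a::euclidean_space \<Rightarrow> 'b::{banach, second_countable_topology}"
  assumes k: "integrable lborel k"
  shows integrable_translate: "integrable lborel (\<lambda>x. k (x - t))"
    and integrable_reflect: "integrable lborel (\<lambda>x. k (t - x))"
proof -
  note [measurable] = borel_measurable_integrable[OF k]
  show "integrable lborel (\<lambda>x. k (x - t))"
    using k integrable_distr_eq[of "\<lambda>x. x - t" lborel borel k] by (simp add: lborel_distr_translate)
  show "integrable lborel (\<lambda>x. k (t - x))"
    using k integrable_distr_eq[of "\<lambda>x. t - x" lborel borel k] by (simp add: lborel_distr_reflect)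
qed

lemma
  fixes k :: "'a::euclidean_space \<Rightarrow> 'b::{banach, second_countable_topology}"
  assumes [measurable]: "k \<in> borel_measurable borel"
  shows integral_translate: "(LINT x|lborel. k (x - t)) = integral\<^sup>L lborel k"
    and integral_reflect: "(LINT x|lborel. k (t - x)) = integral\<^sup>L lborel k"
proof -
  show "(LINT x|lborel. k (x - t)) = integral\<^sup>L lborel k"
    using integral_distr[of "\<lambda>x. x - t" lborel borel k] by (simp add: lborel_distr_translate)
  show "(LINT x|lborel. k (t - x)) = integral\<^sup>L lborel k"
    using integral_distr[of "\<lambda>x. t - x" lborel borel k] by (simp add: lborel_distr_reflect)
qed

lemma AE_lborel_reflect:
  fixes t :: "'a::euclidean_space"
  assumes "AE s in lborel. P (t - s)" and [measurable]: "Measurable.pred borel P"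
  shows "AE u in lborel. P u"
proof -
  have "(AE u in distr lborel borel (\<lambda>s. t - s). P u) = (AE s in lborel. P (t - s))"
    by (rule AE_distr_iff) auto
  then show ?thesis
    unfolding lborel_distr_reflect using assms(1) by simp
qed

lemma integrable_prod_square_integrable:
  fixes k l :: "'a \<Rightarrow> complex"
  assumes "integrable M (\<lambda>t. (cmod (k t))\<^sup>2)" "integrable M (\<lambda>t. (cmod (l t))\<^sup>2)"
    and [measurable]: "k \<in> borel_measurable M" "l \<in> borel_measurable M"
  shows "integrable M (\<lambda>t. k t * l t)"
proof (rule Bochner_Integration.integrable_bound)
  show "integrable M (\<lambda>t. (cmod (k t))\<^sup>2 + (cmod (l t))\<^sup>2)"
    using assms by simp
  have "x * y \<le> x\<^sup>2 + y\<^sup>2" if "x \<ge> 0" "y \<ge> 0" for x y :: real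
    using sum_squares_bound[of x y] mult_nonneg_nonneg[OF that] by linarith
  then show "AE t in M. norm (k t * l t) \<le> norm ((cmod (k t))\<^sup>2 + (cmod (l t))\<^sup>2)"
    by (auto simp: norm_mult)
qed measurable

lemma
  fixes k l :: "'a::euclidean_space \<Rightarrow> complex"
  assumes k: "integrable lborel k" and l: "integrable lborel l"
  shows integrable_convolution: "integrable lborel (\<lambda>x. LINT t|lborel. k t * l (x - t))"
    and fourier_convolution:
      "(LINT x|lborel. exp (\<i> * complex_of_real (x \<bullet> w)) * (LINT t|lborel. k t * l (x - t)))
        = (LINT t|lborel. exp (\<i> * complex_of_real (t \<bullet> w)) * k t)
          * (LINT t|lborel. exp (\<i> * complex_of_real (t \<bullet> w)) * l t)"
proof -
  note [measurable] = borel_measurable_integrable[OF k] borel_measurable_integrable[OF l]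
  have I: "integrable (lborel \<Otimes>\<^sub>M lborel) (\<lambda>(t, x). k t * l (x - t))"
  proof (rule lborel_pair.Fubini_integrable)
    show "AE t in lborel. integrable lborel (\<lambda>x. case (t, x) of (t, x) \<Rightarrow> k t * l (x - t))"
      using integrable_translate[OF l] by simp
    have "(LINT x|lborel. norm (k t * l (x - t))) = norm (k t) * (LINT x|lborel. norm (l x))" for t
      using integral_translate[of "\<lambda>x. norm (l x)" t] by (simp add: norm_mult)
    then show "integrable lborel (\<lambda>t. LINT x|lborel. norm (case (t, x) of (t, x) \<Rightarrow> k t * l (x - t)))"
      using k by simp
  qed measurable
  then have I2: "integrable (lborel \<Otimes>\<^sub>M lborel) (\<lambda>(x, t). k t * l (x - t))"
    using lborel_pair.integrable_product_swap[OF I] by (simp add: case_prod_unfold)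
  show "integrable lborel (\<lambda>x. LINT t|lborel. k t * l (x - t))"
    using lborel_pair.integrable_fst'[OF I2] by simp
  define e where "e = (\<lambda>t. exp (\<i> * complex_of_real (t \<bullet> w)))"
  have [measurable]: "e \<in> borel_measurable borel" unfolding e_def by measurable
  have e: "norm (e t) = 1" "e (x + y) = e x * e y" for t x y
    by (auto simp: e_def exp_add[symmetric] algebra_simps inner_add_left)
  have I3: "integrable (lborel \<Otimes>\<^sub>M lborel) (\<lambda>(t, x). e x * (k t * l (x - t)))"
    by (rule Bochner_Integration.integrable_bound[OF I]) (auto simp: norm_mult e)
  have "(LINT x|lborel. e x * (LINT t|lborel. k t * l (x - t)))
      = (LINT x|lborel. LINT t|lborel. e x * (k t * l (x - t)))"
    by simp
  also have "\<dots> = (LINT t|lborel. LINT x|lborel. e x * (k t * l (x - t)))"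
    by (rule lborel_pair.Fubini_integral[OF I3])
  also have "\<dots> = (LINT t|lborel. e t * k t * (LINT x|lborel. e x * l x))"
  proof (intro Bochner_Integration.integral_cong refl)
    fix t
    have "(LINT x|lborel. e x * (k t * l (x - t))) = (LINT x|lborel. e t * k t * (e (x - t) * l (x - t)))"
    proof (intro Bochner_Integration.integral_cong refl)
      fix x
      show "e x * (k t * l (x - t)) = e t * k t * (e (x - t) * l (x - t))"
        using e(2)[of t "x - t"] by simp
    qed
    also have "\<dots> = e t * k t * (LINT x|lborel. e (x - t) * l (x - t))"
      by simp
    also have "(LINT x|lborel. e (x - t) * l (x - t)) = (LINT x|lborel. e x * l x)"
      by (rule integral_translate[of "\<lambda>x. e x * l x"]) measurable
    finally show "(LINT x|lborel. e x * (k t * l (x - t))) = e t * k t * (LINT x|lborel. e x * l x)" .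
  qed
  also have "\<dots> = (LINT t|lborel. e t * k t) * (LINT x|lborel. e x * l x)"
    by simp
  finally show "(LINT x|lborel. exp (\<i> * complex_of_real (x \<bullet> w)) * (LINT t|lborel. k t * l (x - t)))
        = (LINT t|lborel. exp (\<i> * complex_of_real (t \<bullet> w)) * k t)
          * (LINT t|lborel. exp (\<i> * complex_of_real (t \<bullet> w)) * l t)"
    unfolding e_def .
qed

text \<open>Fixing one good point \<open>t\<close> with \<open>f t\<close> nonzero makes
  \<open>f\<close> a constant multiple of \<open>h\<close> almost everywhere; the tensor identity at
  a second pair of points forces the constant to have modulus 1.\<close>

lemma phase_if_tensor_eq:
  fixes f h :: "'a \<Rightarrow> complex"
  assumes ae: "AE t in M. AE u in M. f t * cnj (f u) = h t * cnj (h u)"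
  shows "\<exists>c. cmod c = 1 \<and> (AE t in M. f t = c * h t)"
proof (cases "AE t in M. f t = 0")
  case True
  have "AE t in M. h t = 0"
  proof (rule ccontr)
    assume n: "\<not> (AE t in M. h t = 0)"
    have "\<not> (AE t in M. \<not> ((AE u in M. f t * cnj (f u) = h t * cnj (h u)) \<and> f t = 0 \<and> h t \<noteq> 0))"
    proof
      assume "AE t in M. \<not> ((AE u in M. f t * cnj (f u) = h t * cnj (h u)) \<and> f t = 0 \<and> h t \<noteq> 0)"
      with ae True have "AE t in M. h t = 0" by eventually_elim auto
      with n show False by simp
    qed
    then obtain t where t: "AE u in M. f t * cnj (f u) = h t * cnj (h u)" "f t = 0" "h t \<noteq> 0"
      by (auto dest: not_eventuallyD)
    from t(1) have "AE u in M. h u = 0"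
      by eventually_elim (use t in auto)
    with n show False by simp
  qed
  with True have "AE t in M. f t = 1 * h t" by eventually_elim auto
  then show ?thesis by (intro exI[of _ 1]) auto
next
  case n: False
  \<comment> \<open>Since \<open>f\<close> does not vanish almost everywhere, any property that
    holds almost everywhere holds at some point where \<open>f\<close> is nonzero.\<close>
  have ex: "\<exists>t. P t \<and> f t \<noteq> 0" if "AE t in M. P t" for P
  proof (rule ccontr)
    assume "\<not> (\<exists>t. P t \<and> f t \<noteq> 0)"
    with that have "AE t in M. f t = 0" by (auto elim: eventually_mono)
    with n show False by simp
  qed
  from ex[OF ae] obtain t where t: "AE u in M. f t * cnj (f u) = h t * cnj (h u)" "f t \<noteq> 0" by blast
  define c where "c = cnj (h t / f t)"
  from t(1) have c: "AE u in M. f u = c * h u"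
  proof eventually_elim
    case (elim u)
    then have "cnj (f u) = h t / f t * cnj (h u)" using t(2) by (simp add: field_simps)
    then have "cnj (cnj (f u)) = cnj (h t / f t * cnj (h u))" by (rule arg_cong)
    then show ?case by (simp add: c_def)
  qed
  \<comment> \<open>The point \<open>t\<close> that defined \<open>c\<close> may be exceptional for
    \<open>f = c * h\<close>, so fresh points satisfying both relations are chosen.\<close>
  have "AE t in M. (AE u in M. f t * cnj (f u) = h t * cnj (h u)) \<and> f t = c * h t"
    using ae c by eventually_elim auto
  from ex[OF this] obtain t' where t': "AE u in M. f t' * cnj (f u) = h t' * cnj (h u)" "f t' = c * h t'" "f t' \<noteq> 0"
    by blast
  have "AE u in M. f t' * cnj (f u) = h t' * cnj (h u) \<and> f u = c * h u"
    using t'(1) c by eventually_elim auto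
  from ex[OF this] obtain u where u: "f t' * cnj (f u) = h t' * cnj (h u)" "f u = c * h u" "f u \<noteq> 0"
    by blast
  have "(c * cnj c) * (h t' * cnj (h u)) = h t' * cnj (h u)"
    using u t' by (simp add: ac_simps)
  moreover have "h t' * cnj (h u) \<noteq> 0" using u t' by auto
  ultimately have "c * cnj c = 1" by simp
  then have "(cmod c)\<^sup>2 = 1"
    by (metis complex_norm_square of_real_eq_1_iff)
  then have "cmod c = 1"
    by (simp add: power2_eq_1_iff) (smt (verit) norm_ge_zero)
  with c show ?thesis by blast
qed

text \<open>
  \<open>cmod (V f x w)\<^sup>2\<close> is, in \<open>w\<close>, the Fourier transform of the autocorrelation of \<open>t \<mapsto> \<phi> (t - x) * cnj (f t)\<close>.
  At lag \<open>s\<close> this autocorrelation is, as a function of \<open>x\<close>, a convolution of \<open>t \<mapsto> cnj (f t) * f (t - s)\<close>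
  with a kernel built from \<open>\<phi>\<close>, which can be undone where the Fourier transform of the kernel is nonzero.
\<close>

lemma phase_retrieval_full:
  fixes \<phi> f h :: "'a::euclidean_space \<Rightarrow> complex"
  assumes cont: "continuous_on UNIV \<phi>" and bdd: "\<And>t. cmod (\<phi> t) \<le> C" and int: "integrable lborel \<phi>"
    and dense: "\<And>s w. w \<in> closure {w. (LINT t|lborel. exp (\<i> * complex_of_real (t \<bullet> w)) * (\<phi> (t - s) * cnj (\<phi> t))) \<noteq> 0}"
    and meas[measurable]: "f \<in> borel_measurable borel" "h \<in> borel_measurable borel"
    and sq: "integrable lborel (\<lambda>t. (cmod (f t))\<^sup>2)" "integrable lborel (\<lambda>t. (cmod (h t))\<^sup>2)"
    and eq: "\<And>x w. cmod (LINT t|lborel. exp (\<i> * complex_of_real (t \<bullet> w)) * (\<phi> (t - x) * cnj (f t)))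
      = cmod (LINT t|lborel. exp (\<i> * complex_of_real (t \<bullet> w)) * (\<phi> (t - x) * cnj (h t)))"
  shows "\<exists>c. cmod c = 1 \<and> (AE t in lborel. f t = c * h t)"
proof -
  have \<phi>[measurable]: "\<phi> \<in> borel_measurable borel"
    by (rule borel_measurable_continuous_onI[OF cont])
  have C: "C \<ge> 0" using order_trans[OF norm_ge_zero bdd] by blast
  have sq\<phi>: "integrable lborel (\<lambda>t. (cmod (\<phi> t))\<^sup>2)"
  proof (rule Bochner_Integration.integrable_bound)
    show "integrable lborel (\<lambda>t. C * cmod (\<phi> t))" using int by simp
    show "AE t in lborel. norm ((cmod (\<phi> t))\<^sup>2) \<le> norm (C * cmod (\<phi> t))"
      using bdd C by (auto simp: power2_eq_square intro!: mult_right_mono)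
  qed measurable
  have sq_shift: "integrable lborel (\<lambda>t. (cmod (k (t - s)))\<^sup>2)" if "integrable lborel (\<lambda>t. (cmod (k t))\<^sup>2)"
    for k :: "'a \<Rightarrow> complex" and s
    using integrable_translate[OF that] .
  define G where "G = (\<lambda>k x t. \<phi> (t - x) * cnj (k t))"
  have G_meas[measurable]: "G k x \<in> borel_measurable borel" if [measurable]: "k \<in> borel_measurable borel" for k x
    unfolding G_def by measurable
  have G: "integrable lborel (G k x)"
    if k: "integrable lborel (\<lambda>t. (cmod (k t))\<^sup>2)" "k \<in> borel_measurable borel" for k x
    unfolding G_def using k sq_shift[OF sq\<phi>]
    by (intro integrable_prod_square_integrable) auto
  define A where "A = (\<lambda>k x s. LINT t|lborel. G k x t * cnj (G k x (t - s)))"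
  have A: "integrable lborel (A k x)"
      "(LINT s|lborel. exp (\<i> * complex_of_real (s \<bullet> w)) * A k x s)
        = (cmod (LINT t|lborel. exp (\<i> * complex_of_real (t \<bullet> w)) * G k x t))\<^sup>2"
    if k: "integrable lborel (\<lambda>t. (cmod (k t))\<^sup>2)" and [measurable]: "k \<in> borel_measurable borel" for k x w
  proof -
    \<comment> \<open>Reflecting and conjugating a function conjugates its Fourier transform, so the
      convolution of \<open>G k x\<close> with \<open>?l\<close>, which is the autocorrelation, has
      the squared modulus as its transform.\<close>
    let ?l = "\<lambda>y. cnj (G k x (- y))"
    have l: "integrable lborel ?l"
      using integrable_reflect[OF G[OF k that(2)], of x 0] by simp
    have [simp]: "?l (s - t) = cnj (G k x (t - s))" for s t by simp
    show "integrable lborel (A k x)"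
      using integrable_convolution[OF G[OF k that(2), of x] l] by (simp add: A_def)
    have "(LINT t|lborel. exp (\<i> * complex_of_real (t \<bullet> w)) * ?l t)
        = (LINT t|lborel. exp (\<i> * complex_of_real ((0 - t) \<bullet> w)) * ?l (0 - t))"
      by (rule integral_reflect[symmetric]) measurable
    also have "\<dots> = (LINT t|lborel. cnj (exp (\<i> * complex_of_real (t \<bullet> w)) * G k x t))"
      by (simp add: exp_cnj)
    also have "\<dots> = cnj (LINT t|lborel. exp (\<i> * complex_of_real (t \<bullet> w)) * G k x t)"
      by (rule Bochner_Integration.integral_cnj)
    finally show "(LINT s|lborel. exp (\<i> * complex_of_real (s \<bullet> w)) * A k x s)
        = (cmod (LINT t|lborel. exp (\<i> * complex_of_real (t \<bullet> w)) * G k x t))\<^sup>2"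
      using fourier_convolution[OF G[OF k that(2), of x] l, of w] by (simp add: A_def complex_norm_square del: of_real_power)
  qed
  have A_eq: "AE s in lborel. A f x s = A h x s" for x
  proof -
    have "AE s in lborel. A f x s - A h x s = 0"
    proof (rule fourier_uniqueness)
      show "integrable lborel (\<lambda>s. A f x s - A h x s)"
        using A(1) sq by simp
      fix w
      let ?e = "\<lambda>s::'a. exp (\<i> * complex_of_real (s \<bullet> w))"
      have i: "integrable lborel (\<lambda>s. ?e s * k s)" if "integrable lborel k" for k
        using borel_measurable_integrable[OF that]
        by (intro Bochner_Integration.integrable_bound[OF that]) (auto simp: norm_mult)
      show "(LINT s|lborel. ?e s * (A f x s - A h x s)) = 0"
        using eq[of w x] i[OF A(1)[OF sq(1)]] i[OF A(1)[OF sq(2)]] A(2)[OF sq(1), of w x] A(2)[OF sq(2), of w x]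
        by (simp add: right_diff_distrib G_def)
    qed
    then show ?thesis by eventually_elim simp
  qed
  \<comment> \<open>Regrouping the four factors of the autocorrelation: window factors into
    \<open>\<Phi>\<close>, signal factors into \<open>K\<close>. The point \<open>x\<close> survives
    only as a translation of \<open>\<Phi>\<close>, which makes the difference a convolution in
    \<open>x\<close>.\<close>
  define \<Phi> where "\<Phi> = (\<lambda>s t. \<phi> t * cnj (\<phi> (t - s)))"
  define K where "K = (\<lambda>s t. cnj (f t) * f (t - s) - cnj (h t) * h (t - s))"
  have [measurable]: "\<Phi> s \<in> borel_measurable borel" "K s \<in> borel_measurable borel" for s
    unfolding \<Phi>_def K_def by measurable
  have \<Phi>_bdd: "cmod (\<Phi> s t) \<le> C * C" for s t
    unfolding \<Phi>_def norm_mult using bdd C by (auto intro!: mult_mono)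
  have \<Phi>_int: "integrable lborel (\<Phi> s)" for s
    unfolding \<Phi>_def using sq\<phi> sq_shift[OF sq\<phi>, of s] by (intro integrable_prod_square_integrable) auto
  have KK: "integrable lborel (\<lambda>t. cnj (k t) * k (t - s))"
    if k: "integrable lborel (\<lambda>t. (cmod (k t))\<^sup>2)" and [measurable]: "k \<in> borel_measurable borel" for k :: "'a \<Rightarrow> complex" and s
    using k sq_shift[OF k, of s] by (intro integrable_prod_square_integrable) auto
  have K_int: "integrable lborel (K s)" for s
    unfolding K_def using KK sq by simp
  have A_diff: "A f x s - A h x s = (LINT t|lborel. K s t * \<Phi> s (t - x))" for x s
  proof -
    have Aint: "integrable lborel (\<lambda>t. (cnj (k t) * k (t - s)) * \<Phi> s (t - x))"
      if k: "integrable lborel (\<lambda>t. (cmod (k t))\<^sup>2)" and [measurable]: "k \<in> borel_measurable borel" for k :: "'a \<Rightarrow> complex"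
    proof (rule Bochner_Integration.integrable_bound)
      show "integrable lborel (\<lambda>t. (C * C) *\<^sub>R (cnj (k t) * k (t - s)))"
        using KK[OF k, of s] by simp
      show "AE t in lborel. norm (cnj (k t) * k (t - s) * \<Phi> s (t - x)) \<le> norm ((C * C) *\<^sub>R (cnj (k t) * k (t - s)))"
        using \<Phi>_bdd C by (auto simp: norm_mult mult.commute[of _ "cmod (\<Phi> _ _)"] intro!: mult_right_mono AE_I2)
    qed measurable
    have "A k x s = (LINT t|lborel. (cnj (k t) * k (t - s)) * \<Phi> s (t - x))" for k
      unfolding A_def G_def \<Phi>_def
      by (intro Bochner_Integration.integral_cong refl) (simp add: algebra_simps)
    then show ?thesis
      using Aint[OF sq(1)] Aint[OF sq(2)] by (simp add: K_def left_diff_distrib)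
  qed
  \<comment> \<open>The null set of lags in \<open>A_eq\<close> depends on \<open>x\<close>. A
    countable dense set of \<open>x\<close> gives a single null set, and continuity of the
    convolution in \<open>x\<close> recovers the remaining points.\<close>
  obtain D :: "'a set" where D: "countable D" "\<And>X. open X \<Longrightarrow> X \<noteq> {} \<Longrightarrow> \<exists>d\<in>D. d \<in> X"
    using countable_dense_exists by blast
  have D_closure: "x \<in> closure D" for x
    using D(2) by (auto simp: closure_iff_nhds_not_empty)
  have "AE s in lborel. \<forall>x\<in>D. A f x s = A h x s"
    using A_eq D(1) by (simp add: AE_ball_countable)
  then have "AE s in lborel. AE t in lborel. K s t = 0"
  proof eventually_elim
    case (elim s)
    have zero: "(LINT t|lborel. K s t * \<Phi> s (t - x)) = 0" for x
    proof -
      obtain X where X: "\<And>n. X n \<in> D" "X \<longlonglongrightarrow> x"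
        using D_closure[of x] unfolding closure_sequential by blast
      have "(\<lambda>n. LINT t|lborel. K s t * \<Phi> s (t - X n)) \<longlonglongrightarrow> (LINT t|lborel. K s t * \<Phi> s (t - x))"
      proof (rule integral_dominated_convergence[where w="\<lambda>t. (C * C) * norm (K s t)"])
        have "continuous_on UNIV (\<Phi> s)"
          unfolding \<Phi>_def by (intro continuous_intros continuous_on_compose2[OF cont]) auto
        then have "isCont (\<Phi> s) y" for y by (simp add: continuous_on_eq_continuous_at)
        then have "(\<lambda>n. \<Phi> s (t - X n)) \<longlonglongrightarrow> \<Phi> s (t - x)" for t
          by (rule isCont_tendsto_compose) (intro tendsto_intros X)
        then show "AE t in lborel. (\<lambda>n. K s t * \<Phi> s (t - X n)) \<longlonglongrightarrow> K s t * \<Phi> s (t - x)"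
          by (intro AE_I2 tendsto_intros)
        show "AE t in lborel. norm (K s t * \<Phi> s (t - X n)) \<le> (C * C) * norm (K s t)" for n
          using \<Phi>_bdd by (auto simp: norm_mult mult.commute[of _ "cmod (\<Phi> _ _)"] intro!: mult_right_mono AE_I2)
      qed (use K_int in auto)
      moreover have "(LINT t|lborel. K s t * \<Phi> s (t - X n)) = 0" for n
        using elim X(1)[of n] by (simp add: A_diff[symmetric])
      ultimately show ?thesis by (simp add: LIMSEQ_const_iff)
    qed
    let ?F = "\<lambda>w. LINT t|lborel. exp (\<i> * complex_of_real (t \<bullet> w)) * K s t"
    let ?l = "\<lambda>y. \<Phi> s (- y)"
    let ?W = "{w. (LINT t|lborel. exp (\<i> * complex_of_real (t \<bullet> w)) * (\<phi> (t - s) * cnj (\<phi> t))) \<noteq> 0}"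
    have l: "integrable lborel ?l"
      using integrable_reflect[OF \<Phi>_int, of s 0] by simp
    \<comment> \<open>The vanishing convolution has transform \<open>?F w\<close> times that of
      \<open>?l\<close>; the latter is the conjugate of the ambiguity function of the window and is
      nonzero on \<open>?W\<close>.\<close>
    have FW: "?F w = 0" if w: "w \<in> ?W" for w
    proof -
      have "(LINT t|lborel. exp (\<i> * complex_of_real (t \<bullet> w)) * ?l t)
        = (LINT t|lborel. exp (\<i> * complex_of_real ((0 - t) \<bullet> w)) * ?l (0 - t))"
        by (rule integral_reflect[symmetric]) measurable
      also have "\<dots> = (LINT t|lborel. cnj (exp (\<i> * complex_of_real (t \<bullet> w)) * (\<phi> (t - s) * cnj (\<phi> t))))"
        by (intro Bochner_Integration.integral_cong refl) (simp add: exp_cnj \<Phi>_def)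
      also have "\<dots> = cnj (LINT t|lborel. exp (\<i> * complex_of_real (t \<bullet> w)) * (\<phi> (t - s) * cnj (\<phi> t)))"
        by (rule Bochner_Integration.integral_cnj)
      finally have "(LINT t|lborel. exp (\<i> * complex_of_real (t \<bullet> w)) * ?l t) \<noteq> 0"
        using w by simp
      then show ?thesis
        using fourier_convolution[OF K_int[of s] l, of w] zero by simp
    qed
    have "?F w = 0" for w
    proof -
      obtain X where X: "\<And>n. X n \<in> ?W" "X \<longlonglongrightarrow> w"
        using dense[of w s] unfolding closure_sequential by blast
      have "(\<lambda>n. ?F (X n)) \<longlonglongrightarrow> ?F w"
      proof (rule integral_dominated_convergence[where w="\<lambda>t. norm (K s t)"])
        show "AE t in lborel. (\<lambda>n. exp (\<i> * complex_of_real (t \<bullet> X n)) * K s t)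
            \<longlonglongrightarrow> exp (\<i> * complex_of_real (t \<bullet> w)) * K s t"
          by (intro AE_I2 tendsto_intros X)
      qed (use K_int in \<open>auto simp: norm_mult\<close>)
      moreover have "?F (X n) = 0" for n
        by (rule FW[OF X(1)])
      ultimately show ?thesis by (simp add: LIMSEQ_const_iff)
    qed
    then show ?case
      by (intro fourier_uniqueness K_int)
  qed
  \<comment> \<open>With \<open>t\<close> fixed outermost, the lag \<open>s\<close> can be replaced
    by u = t - s, which turns \<open>K s t = 0\<close> into the tensor identity.\<close>
  then have "AE t in lborel. AE s in lborel. K s t = 0"
  proof (subst (asm) lborel_pair.AE_commute)
    have "Measurable.pred (lborel \<Otimes>\<^sub>M lborel) (\<lambda>x. K (fst x) (snd x) = 0)"
      unfolding K_def by measurable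
    then show "{x \<in> space (lborel \<Otimes>\<^sub>M lborel). K (fst x) (snd x) = 0} \<in> sets (lborel \<Otimes>\<^sub>M lborel)"
      by (simp only: pred_def)
  qed
  then have "AE t in lborel. AE u in lborel. f t * cnj (f u) = h t * cnj (h u)"
  proof eventually_elim
    case (elim t)
    have "AE u in lborel. cnj (f t) * f u - cnj (h t) * h u = 0"
      by (rule AE_lborel_reflect[of _ t]) (use elim in \<open>auto simp: K_def\<close>)
    then show ?case
    proof eventually_elim
      case (elim u)
      then have "cnj (cnj (f t) * f u) = cnj (cnj (h t) * h u)" by simp
      then show ?case by simp
    qed
  qed
  then show ?thesis by (rule phase_if_tensor_eq)
qed

section \<open>Windows of Gaussian decay\<close>

definition cvec :: "real ^ 'd \<Rightarrow> complex ^ 'd" where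
  "cvec x = (\<chi> j. complex_of_real (x $ j))"

definition weighted_square :: "real ^ 'd \<Rightarrow> real ^ 'd \<Rightarrow> real" where
  "weighted_square m t = (\<Sum>j\<in>UNIV. m $ j * (t $ j)\<^sup>2)"

text \<open>Complex linearity of the Frechet derivative is what makes the chain rule yield a complex
  derivative, multiplication by \<open>D q\<close>.\<close>

lemma entire_fun_line:
  assumes "entire_fun F"
  shows "(\<lambda>z. F (p + z *s q)) holomorphic_on UNIV"
proof -
  have "\<exists>D. ((\<lambda>z. F (p + z *s q)) has_field_derivative D) (at z0)" for z0
  proof -
    obtain D where D: "(F has_derivative D) (at (p + z0 *s q))" "\<And>k w. D (k *s w) = k * D w"
      using assms unfolding entire_fun_def by blast
    have "bounded_linear (\<lambda>h::complex. h *s q)"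
      by (subst linear_conv_bounded_linear[symmetric])
         (auto intro!: linearI simp: vec_eq_iff algebra_simps)
    then have "((\<lambda>z. p + z *s q) has_derivative (\<lambda>h. h *s q)) (at z0)"
      by (auto intro!: derivative_eq_intros bounded_linear_imp_has_derivative)
    from diff_chain_at[OF this D(1)]
    have "((\<lambda>z. F (p + z *s q)) has_derivative (\<lambda>h. D q * h)) (at z0)"
      by (simp add: o_def D(2) mult.commute)
    then show ?thesis
      unfolding has_field_derivative_def by blast
  qed
  then show ?thesis
    unfolding holomorphic_on_open[OF open_UNIV] by blast
qed

text \<open>Zeros are isolated. The witness \<open>a\<close> may lie off the real axis, so
  nonvanishing at a complex point passes to real points near any \<open>r0\<close>.\<close>

lemma eventually_nonzero_on_reals:
  assumes "F holomorphic_on UNIV" "F a \<noteq> 0"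
  shows "eventually (\<lambda>r. F (complex_of_real r) \<noteq> 0) (at r0)"
proof -
  have "eventually (\<lambda>z. F z \<noteq> 0 \<and> z \<in> UNIV) (at (complex_of_real r0))"
    by (rule non_zero_neighbour_alt[where \<beta>=a]) (use assms in auto)
  moreover have "filterlim complex_of_real (at (complex_of_real r0)) (at r0)"
    by (auto simp: filterlim_at eventually_at_filter intro!: tendsto_intros)
  ultimately show ?thesis
    by (auto simp: filterlim_iff)
qed

lemma weighted_square_lower_bound:
  fixes m :: "real ^ 'd"
  assumes "\<And>j. m $ j > 0"
  obtains r where "r > 0" "\<And>t. weighted_square m t \<ge> r * (t \<bullet> t)"
proof
  let ?r = "Min (range (($) m))"
  show "?r > 0" using assms by (subst Min_gr_iff) auto
  show "weighted_square m t \<ge> ?r * (t \<bullet> t)" for t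
    unfolding weighted_square_def inner_vec_def sum_distrib_left
    by (intro sum_mono) (auto simp: power2_eq_square intro!: mult_right_mono Min_le)
qed

locale gaussian_window =
  fixes m n :: "real ^ 'd" and \<phi> :: "complex ^ 'd \<Rightarrow> complex" and C :: real
  assumes m: "\<And>j. m $ j > 0"
    and n: "\<And>j. n $ j > 0"
    and entire: "entire_fun \<phi>"
    and C: "C > 0"
    and bound: "\<And>x y. cmod (\<phi> (cvec x + \<i> *s cvec y)) \<le> C * exp (- weighted_square m x + weighted_square n y)"
    and nonzero: "\<phi> \<noteq> (\<lambda>_. 0)"
begin

abbreviation "qm \<equiv> weighted_square m"
abbreviation "qn \<equiv> weighted_square n"

text \<open>The shift that completes the square: \<open>qm s + y * (s \<bullet> \<beta>)\<close> is
  minimal at \<open>s = - (y *\<^sub>R dual \<beta>)\<close>.\<close>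

definition dual :: "real ^ 'd \<Rightarrow> real ^ 'd" where
  "dual \<beta> = (\<chi> j. \<beta> $ j / (2 * m $ j))"

text \<open>The coefficient of (Im z)^2 in the growth exponent of \<open>V\<close>:
  \<open>qm (dual \<beta>)\<close>, the sum of \<beta>_j^2 / (4 m_j), is the remainder of completing
  the square, and \<open>qn \<alpha>\<close> is the growth of the window in imaginary
  directions.\<close>

definition rate :: "real ^ 'd \<Rightarrow> real ^ 'd \<Rightarrow> real" where
  "rate \<alpha> \<beta> = qm (dual \<beta>) + qn \<alpha>"

text \<open>
  \<open>V f x w \<alpha> \<beta>\<close> is the extension to complex \<open>z\<close> of the (conjugated) short-time Fourier transform of \<open>f\<close>
  at the point \<open>(x + z *\<^sub>R \<alpha>, w + z *\<^sub>R \<beta>)\<close>.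
\<close>

definition V_integrand where
  "V_integrand f x w \<alpha> \<beta> z t = exp (\<i> * (complex_of_real (t \<bullet> w) + z * complex_of_real (t \<bullet> \<beta>)))
     * (\<phi> (cvec (t - x) + z *s cvec (- \<alpha>)) * cnj (f t))"

definition V where
  "V f x w \<alpha> \<beta> z = (LINT t|lborel. V_integrand f x w \<alpha> \<beta> z t)"

lemma qm_nonneg: "qm t \<ge> 0" and qn_nonneg: "qn t \<ge> 0"
  unfolding weighted_square_def
  by (intro sum_nonneg mult_nonneg_nonneg less_imp_le[OF m] less_imp_le[OF n] zero_le_power2)+

lemma rate_nonneg: "rate \<alpha> \<beta> \<ge> 0"
  unfolding rate_def using qm_nonneg qn_nonneg by (simp add: add_nonneg_nonneg)

lemma weighted_square_scaleR: "weighted_square k (r *\<^sub>R t) = r\<^sup>2 * weighted_square k t"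
  by (simp add: weighted_square_def sum_distrib_left power_mult_distrib ac_simps)

lemma qm_complete_square:
  "qm (s + y *\<^sub>R dual \<beta>) = qm s + y * (s \<bullet> \<beta>) + y\<^sup>2 * qm (dual \<beta>)"
proof -
  have "m $ j * (s $ j + y * (\<beta> $ j / (2 * m $ j)))\<^sup>2
     = m $ j * (s $ j)\<^sup>2 + y * (s $ j * \<beta> $ j) + y\<^sup>2 * (m $ j * (\<beta> $ j / (2 * m $ j))\<^sup>2)" for j
    using m[of j] by (simp add: power2_eq_square field_simps)
  then show ?thesis
    by (simp add: weighted_square_def dual_def inner_vec_def sum.distrib sum_distrib_left)
qed

text \<open>Half the Gaussian exponent survives a translation, so one wider Gaussian dominates all
  translates by bounded \<open>p\<close>. Coordinatewise the difference of the two sides is (s -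
  2p)^2 / 2 times the weight.\<close>

lemma qm_translate: "qm (s - p) \<ge> qm s / 2 - qm p"
proof -
  have "m $ j * (s $ j)\<^sup>2 / 2 - m $ j * (p $ j)\<^sup>2 \<le> m $ j * (s $ j - p $ j)\<^sup>2" for j
  proof -
    have "(s $ j)\<^sup>2 / 2 - (p $ j)\<^sup>2 \<le> (s $ j - p $ j)\<^sup>2"
      using zero_le_power2[of "s $ j - 2 * p $ j"] by (simp add: power2_eq_square algebra_simps)
    from mult_left_mono[OF this, of "m $ j"] m[of j] show ?thesis by (simp add: algebra_simps)
  qed
  then show ?thesis
    by (simp add: weighted_square_def sum_divide_distrib sum_subtractf[symmetric] sum_mono)
qed

text \<open>After completing the square, the complex part of \<open>z\<close> only moves the centre
  of the Gaussian; all other growth is independent of \<open>t\<close> and leaves the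
  integral.\<close>

lemma norm_V_integrand:
  fixes z :: complex
  defines "u \<equiv> Re z" and "y \<equiv> Im z"
  shows "norm (V_integrand f x w \<alpha> \<beta> z t)
    \<le> C * exp (- y * ((x + u *\<^sub>R \<alpha>) \<bullet> \<beta>) + y\<^sup>2 * rate \<alpha> \<beta>)
        * exp (- qm (t - (x + u *\<^sub>R \<alpha> - y *\<^sub>R dual \<beta>))) * cmod (f t)"
proof -
  let ?s = "t - x - u *\<^sub>R \<alpha>"
  have "cvec (t - x) + z *s cvec (- \<alpha>) = cvec ?s + \<i> *s cvec (- (y *\<^sub>R \<alpha>))"
    by (auto simp: cvec_def vec_eq_iff complex_eq_iff u_def y_def)
  then have 1: "cmod (\<phi> (cvec (t - x) + z *s cvec (- \<alpha>))) \<le> C * exp (- qm ?s + qn (- (y *\<^sub>R \<alpha>)))"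
    using bound by metis
  have 2: "qn (- (y *\<^sub>R \<alpha>)) = y\<^sup>2 * qn \<alpha>"
    using weighted_square_scaleR[of n "- y" \<alpha>] by simp
  have 3: "t - (x + u *\<^sub>R \<alpha> - y *\<^sub>R dual \<beta>) = ?s + y *\<^sub>R dual \<beta>"
    by (simp add: algebra_simps)
  have 4: "t \<bullet> \<beta> = ?s \<bullet> \<beta> + (x + u *\<^sub>R \<alpha>) \<bullet> \<beta>"
    by (simp add: inner_diff_left inner_add_left)
  have "norm (V_integrand f x w \<alpha> \<beta> z t)
      = exp (- y * (t \<bullet> \<beta>)) * cmod (\<phi> (cvec (t - x) + z *s cvec (- \<alpha>))) * cmod (f t)"
    by (simp add: V_integrand_def norm_mult y_def)
  also have "\<dots> \<le> exp (- y * (t \<bullet> \<beta>)) * (C * exp (- qm ?s + qn (- (y *\<^sub>R \<alpha>)))) * cmod (f t)"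
    using 1 by (intro mult_right_mono mult_left_mono) auto
  also have "\<dots> = C * exp (- y * (t \<bullet> \<beta>) - qm ?s + y\<^sup>2 * qn \<alpha>) * cmod (f t)"
    unfolding 2 by (simp add: exp_add exp_diff exp_minus field_simps)
  also have "- y * (t \<bullet> \<beta>) - qm ?s + y\<^sup>2 * qn \<alpha>
      = (- y * ((x + u *\<^sub>R \<alpha>) \<bullet> \<beta>) + y\<^sup>2 * rate \<alpha> \<beta>) + (- qm (t - (x + u *\<^sub>R \<alpha> - y *\<^sub>R dual \<beta>)))"
    unfolding 3 qm_complete_square rate_def unfolding 4 by (simp add: algebra_simps)
  finally show ?thesis
    by (simp only: exp_add ac_simps)
qed

lemma continuous_cvec [continuous_intros]:
  "continuous_on A g \<Longrightarrow> continuous_on A (\<lambda>x. cvec (g x))"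
  unfolding cvec_def by (intro continuous_intros)

lemma continuous_on_weighted_square [continuous_intros]:
  "continuous_on A g \<Longrightarrow> continuous_on A (\<lambda>x. weighted_square k (g x))"
  unfolding weighted_square_def by (intro continuous_intros)

lemma continuous_window: "continuous_on A g \<Longrightarrow> continuous_on A (\<lambda>x. \<phi> (g x))"
proof -
  have "continuous_on UNIV \<phi>"
    using entire unfolding entire_fun_def
    by (meson continuous_at_imp_continuous_on has_derivative_continuous)
  then show "continuous_on A g \<Longrightarrow> continuous_on A (\<lambda>x. \<phi> (g x))"
    by (rule continuous_on_compose2) auto
qed

lemma measurable_V_integrand:
  assumes [measurable]: "f \<in> borel_measurable borel"
  shows "V_integrand f x w \<alpha> \<beta> z \<in> borel_measurable lborel"
proof -
  have [measurable]: "(\<lambda>t. \<phi> (cvec (t - x) + z *s cvec (- \<alpha>))) \<in> borel_measurable borel"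
    by (intro borel_measurable_continuous_onI continuous_window)
       (auto simp: vector_scalar_mult_def vec_lambda_beta intro!: continuous_intros)
  show ?thesis
    unfolding V_integrand_def by measurable
qed

lemma integrable_exp_qm:
  assumes "r > 0"
  shows "integrable lborel (\<lambda>t. exp (- r * qm (t - p)))"
proof -
  obtain k where k: "k > 0" "\<And>t. qm t \<ge> k * (t \<bullet> t)"
    using weighted_square_lower_bound m by blast
  have [measurable]: "(\<lambda>t. exp (- r * qm t)) \<in> borel_measurable borel"
    by (intro borel_measurable_continuous_onI continuous_intros)
  have "integrable lborel (\<lambda>t. exp (- r * qm t))"
  proof (rule Bochner_Integration.integrable_bound)
    show "integrable lborel (\<lambda>t::real^'d. exp (- (r * k) * (t \<bullet> t)))"
      using assms k by (intro integrable_gaussian) auto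
    show "AE t in lborel. norm (exp (- r * qm t)) \<le> norm (exp (- (r * k) * (t \<bullet> t)))"
      using assms mult_left_mono[OF k(2), of r] by (auto simp: ac_simps)
  qed measurable
  then show ?thesis
    by (rule integrable_translate)
qed

text \<open>The bound on the integral does not depend on the centre \<open>p\<close>, which is why
  the constant for \<open>V\<close> is uniform over all lines and all \<open>z\<close>.\<close>

lemma
  assumes [measurable]: "f \<in> borel_measurable borel" and sq: "integrable lborel (\<lambda>t. (cmod (f t))\<^sup>2)"
    and r: "r > 0"
  shows integrable_gaussian_times: "integrable lborel (\<lambda>t. exp (- r * qm (t - p)) * cmod (f t))"
    and integral_gaussian_times_le: "(LINT t|lborel. exp (- r * qm (t - p)) * cmod (f t))
      \<le> (LINT t|lborel. exp (- (2 * r) * qm t)) + (LINT t|lborel. (cmod (f t))\<^sup>2)"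
proof -
  have [measurable]: "(\<lambda>t. exp (- k * qm (t - p))) \<in> borel_measurable borel" for k p
    by (intro borel_measurable_continuous_onI continuous_intros)
  have [measurable]: "(\<lambda>t. exp (- k * qm t)) \<in> borel_measurable borel" for k
    by (intro borel_measurable_continuous_onI continuous_intros)
  have I: "integrable lborel (\<lambda>t. exp (- (2 * r) * qm (t - p)) + (cmod (f t))\<^sup>2)"
    using integrable_exp_qm[of "2 * r" p] sq r by simp
  have "x * y \<le> x\<^sup>2 + y\<^sup>2" if "x \<ge> 0" "y \<ge> 0" for x y :: real
    using sum_squares_bound[of x y] mult_nonneg_nonneg[OF that] by linarith
  then have le: "exp (- r * qm (t - p)) * cmod (f t) \<le> exp (- (2 * r) * qm (t - p)) + (cmod (f t))\<^sup>2" for t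
    using exp_double[of "- r * qm (t - p)"] by (simp add: ac_simps)
  show 1: "integrable lborel (\<lambda>t. exp (- r * qm (t - p)) * cmod (f t))"
  proof (rule Bochner_Integration.integrable_bound[OF I])
    show "AE t in lborel. norm (exp (- r * qm (t - p)) * cmod (f t))
        \<le> norm (exp (- (2 * r) * qm (t - p)) + (cmod (f t))\<^sup>2)"
      using le by (auto intro: order_trans[OF _ abs_ge_self])
  qed measurable
  have "(LINT t|lborel. exp (- r * qm (t - p)) * cmod (f t))
      \<le> (LINT t|lborel. exp (- (2 * r) * qm (t - p)) + (cmod (f t))\<^sup>2)"
    using le by (intro integral_mono 1 I) auto
  also have "\<dots> = (LINT t|lborel. exp (- (2 * r) * qm (t - p))) + (LINT t|lborel. (cmod (f t))\<^sup>2)"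
    using integrable_exp_qm[of "2 * r" p] sq r by (intro Bochner_Integration.integral_add) auto
  also have "(LINT t|lborel. exp (- (2 * r) * qm (t - p))) = (LINT t|lborel. exp (- (2 * r) * qm t))"
    by (rule integral_translate[of "\<lambda>t. exp (- (2 * r) * qm t)"]) measurable
  finally show "(LINT t|lborel. exp (- r * qm (t - p)) * cmod (f t))
      \<le> (LINT t|lborel. exp (- (2 * r) * qm t)) + (LINT t|lborel. (cmod (f t))\<^sup>2)" .
qed

lemma integrable_V_integrand:
  assumes f: "f \<in> borel_measurable borel" "integrable lborel (\<lambda>t. (cmod (f t))\<^sup>2)"
  shows "integrable lborel (V_integrand f x w \<alpha> \<beta> z)"
proof (rule Bochner_Integration.integrable_bound)
  let ?p = "x + Re z *\<^sub>R \<alpha> - Im z *\<^sub>R dual \<beta>"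
  let ?e = "C * exp (- Im z * ((x + Re z *\<^sub>R \<alpha>) \<bullet> \<beta>) + (Im z)\<^sup>2 * rate \<alpha> \<beta>)"
  show "integrable lborel (\<lambda>t. ?e * (exp (- 1 * qm (t - ?p)) * cmod (f t)))"
    using integrable_gaussian_times[OF f, of 1 ?p] by simp
  show "AE t in lborel. norm (V_integrand f x w \<alpha> \<beta> z t) \<le> norm (?e * (exp (- 1 * qm (t - ?p)) * cmod (f t)))"
    using norm_V_integrand[of f x w \<alpha> \<beta> z] C by (auto simp: abs_mult ac_simps)
qed (rule measurable_V_integrand[OF f(1)])

text \<open>The term linear in Im z is kept exact rather than estimated, because it changes sign
  under conjugation of \<open>z\<close> and is going to cancel.\<close>

lemma norm_V_le:
  assumes f: "f \<in> borel_measurable borel" "integrable lborel (\<lambda>t. (cmod (f t))\<^sup>2)"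
  shows "\<exists>B\<ge>0. \<forall>x w \<alpha> \<beta> z. norm (V f x w \<alpha> \<beta> z)
    \<le> B * exp (- Im z * ((x + Re z *\<^sub>R \<alpha>) \<bullet> \<beta>) + (Im z)\<^sup>2 * rate \<alpha> \<beta>)"
proof -
  define B where "B = (LINT t|lborel. exp (- 2 * qm t)) + (LINT t|lborel. (cmod (f t))\<^sup>2)"
  have B: "B \<ge> 0"
    unfolding B_def by (intro add_nonneg_nonneg Bochner_Integration.integral_nonneg) auto
  have "norm (V f x w \<alpha> \<beta> z)
    \<le> (C * B) * exp (- Im z * ((x + Re z *\<^sub>R \<alpha>) \<bullet> \<beta>) + (Im z)\<^sup>2 * rate \<alpha> \<beta>)" for x w \<alpha> \<beta> z
  proof -
    let ?e = "C * exp (- Im z * ((x + Re z *\<^sub>R \<alpha>) \<bullet> \<beta>) + (Im z)\<^sup>2 * rate \<alpha> \<beta>)"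
    let ?p = "x + Re z *\<^sub>R \<alpha> - Im z *\<^sub>R dual \<beta>"
    have i: "integrable lborel (\<lambda>t. exp (- qm (t - ?p)) * cmod (f t))"
      using integrable_gaussian_times[OF f, of 1 ?p] by simp
    have "norm (V f x w \<alpha> \<beta> z) \<le> (LINT t|lborel. norm (V_integrand f x w \<alpha> \<beta> z t))"
      unfolding V_def by (rule integral_norm_bound)
    also have "\<dots> \<le> (LINT t|lborel. ?e * (exp (- qm (t - ?p)) * cmod (f t)))"
    proof (rule integral_mono)
      show "norm (V_integrand f x w \<alpha> \<beta> z t) \<le> ?e * (exp (- qm (t - ?p)) * cmod (f t))" for t
        using norm_V_integrand[of f x w \<alpha> \<beta> z t] by (simp add: ac_simps)
    qed (use i integrable_V_integrand[OF f] in auto)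
    also have "\<dots> = ?e * (LINT t|lborel. exp (- qm (t - ?p)) * cmod (f t))"
      by simp
    also have "\<dots> \<le> ?e * B"
      using integral_gaussian_times_le[OF f, of 1 ?p] C by (intro mult_left_mono) (auto simp: B_def)
    finally show ?thesis by (simp add: ac_simps)
  qed
  then show ?thesis
    using B C by (intro exI[of _ "C * B"]) auto
qed

lemma holomorphic_V:
  assumes f: "f \<in> borel_measurable borel" "integrable lborel (\<lambda>t. (cmod (f t))\<^sup>2)"
  shows "V f x w \<alpha> \<beta> holomorphic_on UNIV"
  unfolding V_def
proof (rule holomorphic_parametric_integral)
  show "(\<lambda>z. V_integrand f x w \<alpha> \<beta> z t) holomorphic_on UNIV" for t
    unfolding V_integrand_def by (intro holomorphic_intros entire_fun_line entire)
  show "V_integrand f x w \<alpha> \<beta> z \<in> borel_measurable lborel" for z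
    by (rule measurable_V_integrand[OF f(1)])
  fix R :: real
  \<comment> \<open>Everything that depends on \<open>z\<close> after \<open>qm_translate\<close>
    has freed the Gaussian from its moving centre; continuity bounds it on the disc.\<close>
  define e where "e = (\<lambda>z. C * exp (- Im z * ((x + Re z *\<^sub>R \<alpha>) \<bullet> \<beta>) + (Im z)\<^sup>2 * rate \<alpha> \<beta>)
    * exp (qm (Re z *\<^sub>R \<alpha> - Im z *\<^sub>R dual \<beta>)))"
  have "compact (e ` cball 0 R)"
    unfolding e_def by (intro compact_continuous_image continuous_intros compact_cball)
  then have "bounded (e ` cball 0 R)" by (rule compact_imp_bounded)
  then obtain K where "\<forall>x\<in>e ` cball 0 R. norm x \<le> K"
    unfolding bounded_iff by blast
  then have K: "e z \<le> K" if "norm z \<le> R" for z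
    using that by (auto dest: abs_le_D1)
  have "norm (V_integrand f x w \<alpha> \<beta> z t) \<le> K * (exp (- (1/2) * qm (t - x)) * cmod (f t))"
    if "norm z \<le> R" for z t
  proof -
    let ?p = "Re z *\<^sub>R \<alpha> - Im z *\<^sub>R dual \<beta>"
    have eq: "t - (x + Re z *\<^sub>R \<alpha> - Im z *\<^sub>R dual \<beta>) = (t - x) - ?p" by (simp add: algebra_simps)
    have "exp (- qm ((t - x) - ?p)) \<le> exp (qm ?p) * exp (- (1/2) * qm (t - x))"
      using qm_translate[of "t - x" ?p] by (simp add: exp_add[symmetric])
    from mult_right_mono[OF this norm_ge_zero[of "f t"]]
    have "C * exp (- Im z * ((x + Re z *\<^sub>R \<alpha>) \<bullet> \<beta>) + (Im z)\<^sup>2 * rate \<alpha> \<beta>)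
          * exp (- qm ((t - x) - ?p)) * cmod (f t) \<le> e z * (exp (- (1/2) * qm (t - x)) * cmod (f t))"
      using C unfolding e_def mult.assoc by (intro mult_left_mono) auto
    also have "\<dots> \<le> K * (exp (- (1/2) * qm (t - x)) * cmod (f t))"
      using K[OF that] by (intro mult_right_mono) auto
    finally show ?thesis
      using norm_V_integrand[of f x w \<alpha> \<beta> z t] unfolding eq by simp
  qed
  moreover have "integrable lborel (\<lambda>t. K * (exp (- (1/2) * qm (t - x)) * cmod (f t)))"
    using integrable_gaussian_times[OF f, of "1/2" x] by simp
  ultimately show "\<exists>w'. integrable lborel w' \<and> (\<forall>z t. norm z \<le> R \<longrightarrow> norm (V_integrand f x w \<alpha> \<beta> z t) \<le> w' t)"
    by blast
qed

end

section \<open>Real sampling points: squared modulus along lines and the ambiguity function of the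
  window\<close>

context gaussian_window
begin

text \<open>The conjugate of the usual short-time Fourier transform: conjugation sits on
  \<open>f\<close> instead of the window, so that the dependence on \<open>x\<close> extends
  holomorphically through \<phi>.\<close>

definition stft where
  "stft f x w = (LINT t|lborel. exp (\<i> * complex_of_real (t \<bullet> w)) * (\<phi> (cvec (t - x)) * cnj (f t)))"

lemma V_of_real: "V f x w \<alpha> \<beta> (complex_of_real r) = stft f (x + r *\<^sub>R \<alpha>) (w + r *\<^sub>R \<beta>)"
proof -
  have "cvec (t - x) + complex_of_real r *s cvec (- \<alpha>) = cvec (t - (x + r *\<^sub>R \<alpha>))" for t
    by (simp add: cvec_def vec_eq_iff)
  moreover have "complex_of_real (t \<bullet> w) + complex_of_real r * complex_of_real (t \<bullet> \<beta>)
      = complex_of_real (t \<bullet> (w + r *\<^sub>R \<beta>))" for t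
    by (simp add: inner_add_right)
  ultimately show ?thesis
    unfolding V_def V_integrand_def stft_def by simp
qed

lemma stft_square_line:
  assumes f: "f \<in> borel_measurable borel" "integrable lborel (\<lambda>t. (cmod (f t))\<^sup>2)"
  shows "\<exists>Q B. Q holomorphic_on UNIV \<and> (\<forall>z. norm (Q z) \<le> B * exp (2 * rate \<alpha> \<beta> * (norm z)\<^sup>2)) \<and>
    (\<forall>r. Q (complex_of_real r) = complex_of_real ((cmod (stft f (x + r *\<^sub>R \<alpha>) (w + r *\<^sub>R \<beta>)))\<^sup>2))"
proof -
  define v where "v = V f x w \<alpha> \<beta>"
  define Q where "Q = (\<lambda>z. v z * (cnj \<circ> v \<circ> cnj) z)"
  have v: "v holomorphic_on UNIV" unfolding v_def by (rule holomorphic_V[OF f])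
  have "Q holomorphic_on UNIV"
    unfolding Q_def by (intro holomorphic_on_mult v holomorphic_on_compose_cnj_cnj)
      (auto intro: holomorphic_on_subset[OF v])
  moreover obtain B where B: "B \<ge> 0" "\<And>z. norm (v z) \<le> B * exp (- Im z * ((x + Re z *\<^sub>R \<alpha>) \<bullet> \<beta>) + (Im z)\<^sup>2 * rate \<alpha> \<beta>)"
    using norm_V_le[OF f] unfolding v_def by blast
  have "norm (Q z) \<le> B\<^sup>2 * exp (2 * rate \<alpha> \<beta> * (norm z)\<^sup>2)" for z
  proof -
    have "norm (Q z) = norm (v z) * norm (v (cnj z))" by (simp add: Q_def norm_mult)
    also have "\<dots> \<le> (B * exp (- Im z * ((x + Re z *\<^sub>R \<alpha>) \<bullet> \<beta>) + (Im z)\<^sup>2 * rate \<alpha> \<beta>))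
        * (B * exp (- Im (cnj z) * ((x + Re (cnj z) *\<^sub>R \<alpha>) \<bullet> \<beta>) + (Im (cnj z))\<^sup>2 * rate \<alpha> \<beta>))"
      by (intro mult_mono B) (use B(1) in auto)
    \<comment> \<open>At \<open>z\<close> and \<open>cnj z\<close> the linear terms are opposite,
      since the real parts agree; only the quadratic terms add up.\<close>
    also have "\<dots> = B\<^sup>2 * exp (2 * rate \<alpha> \<beta> * (Im z)\<^sup>2)"
      by (simp add: power2_eq_square exp_add[symmetric] algebra_simps)
    also have "\<dots> \<le> B\<^sup>2 * exp (2 * rate \<alpha> \<beta> * (norm z)\<^sup>2)"
      using rate_nonneg by (auto intro!: mult_left_mono simp: cmod_power2)
    finally show ?thesis .
  qed
  moreover have "Q (complex_of_real r) = complex_of_real ((cmod (stft f (x + r *\<^sub>R \<alpha>) (w + r *\<^sub>R \<beta>)))\<^sup>2)" for r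
    by (simp add: Q_def v_def V_of_real complex_norm_square del: of_real_power)
  ultimately show ?thesis by blast
qed

lemma window_norm_le: "cmod (\<phi> (cvec t)) \<le> C * exp (- qm t)"
proof -
  have "cvec t + \<i> *s cvec 0 = cvec t" by (simp add: cvec_def vec_eq_iff)
  then show ?thesis using bound[of t 0] by (simp add: weighted_square_def)
qed

lemma continuous_on_window_cvec: "continuous_on UNIV (\<lambda>t. \<phi> (cvec t))"
  by (intro continuous_window continuous_intros)

lemma measurable_window_cvec: "(\<lambda>t. \<phi> (cvec t)) \<in> borel_measurable borel"
  by (intro borel_measurable_continuous_onI continuous_on_window_cvec)

lemma integrable_window: "integrable lborel (\<lambda>t. \<phi> (cvec t))"
proof (rule Bochner_Integration.integrable_bound)
  show "integrable lborel (\<lambda>t. C * exp (- 1 * qm (t - 0)))"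
    by (intro integrable_mult_right integrable_exp_qm) auto
  show "AE t in lborel. norm (\<phi> (cvec t)) \<le> norm (C * exp (- 1 * qm (t - 0)))"
    using window_norm_le C by (auto simp: abs_mult)
qed (use measurable_window_cvec in simp)

lemma square_integrable_window: "integrable lborel (\<lambda>t. (cmod (\<phi> (cvec t)))\<^sup>2)"
proof (rule Bochner_Integration.integrable_bound)
  note [measurable] = measurable_window_cvec
  show "(\<lambda>t. (cmod (\<phi> (cvec t)))\<^sup>2) \<in> borel_measurable lborel" by measurable
  show "integrable lborel (\<lambda>t. C\<^sup>2 * exp (- 2 * qm (t - 0)))"
    by (intro integrable_mult_right integrable_exp_qm) auto
  have "(cmod (\<phi> (cvec t)))\<^sup>2 \<le> (C * exp (- qm t))\<^sup>2" for t
    using window_norm_le by (intro power_mono) auto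
  also have "(C * exp (- qm t))\<^sup>2 = C\<^sup>2 * exp (- 2 * qm t)" for t
    by (simp add: power_mult_distrib exp_double[symmetric])
  finally show "AE t in lborel. norm ((cmod (\<phi> (cvec t)))\<^sup>2) \<le> norm (C\<^sup>2 * exp (- 2 * qm (t - 0)))"
    by (auto simp: abs_mult)
qed

text \<open>Through a complex point x + i y with nonzero value runs the complex line x + r y, which
  takes that value at r = i and meets the real space at real r.\<close>

lemma window_nonzero_real: "\<exists>y. \<phi> (cvec y) \<noteq> 0"
proof -
  obtain z where z: "\<phi> z \<noteq> 0" using nonzero by auto
  define x y where "x = (\<chi> j. Re (z $ j))" and "y = (\<chi> j. Im (z $ j))"
  have "cvec x + \<i> *s cvec y = z"
    by (simp add: cvec_def vec_eq_iff x_def y_def complex_eq_iff)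
  with z have "eventually (\<lambda>r. \<phi> (cvec x + complex_of_real r *s cvec y) \<noteq> 0) (at 0)"
    by (intro eventually_nonzero_on_reals[where a=\<i>] entire_fun_line entire) auto
  then obtain r where "\<phi> (cvec x + complex_of_real r *s cvec y) \<noteq> 0"
    using eventually_happens[of _ "at (0::real)"] by auto
  moreover have "cvec x + complex_of_real r *s cvec y = cvec (x + r *\<^sub>R y)"
    by (simp add: cvec_def vec_eq_iff)
  ultimately show ?thesis by metis
qed

text \<open>Along the points y + r s both factors are entire in r; one is nonzero at r = 0 and the
  other at r = 1, so for r near 0, apart from 0 itself, neither vanishes.\<close>

lemma window_shift_product_nonzero: "\<exists>t. \<phi> (cvec (t - s)) * cnj (\<phi> (cvec t)) \<noteq> 0"
proof -
  obtain y where y: "\<phi> (cvec y) \<noteq> 0" using window_nonzero_real by blast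
  have eq: "cvec p + complex_of_real r *s cvec q = cvec (p + r *\<^sub>R q)" for p q :: "real ^ 'd" and r
    by (simp add: cvec_def vec_eq_iff)
  have "eventually (\<lambda>r. \<phi> (cvec y + complex_of_real r *s cvec s) \<noteq> 0) (at 0)"
    by (rule eventually_nonzero_on_reals[where a="complex_of_real 0"])
       (use y in \<open>auto simp only: eq scaleR_zero_left add_0_right intro!: entire_fun_line entire\<close>)
  moreover have "eventually (\<lambda>r. \<phi> (cvec (y - s) + complex_of_real r *s cvec s) \<noteq> 0) (at 0)"
    by (rule eventually_nonzero_on_reals[where a="complex_of_real 1"])
       (use y in \<open>auto simp only: eq scaleR_one diff_add_cancel intro!: entire_fun_line entire\<close>)
  ultimately have "eventually (\<lambda>r::real. \<phi> (cvec (y + r *\<^sub>R s)) \<noteq> 0 \<and> \<phi> (cvec (y - s + r *\<^sub>R s)) \<noteq> 0) (at 0)"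
    unfolding eq by eventually_elim auto
  then obtain r :: real where "\<phi> (cvec (y + r *\<^sub>R s)) \<noteq> 0" "\<phi> (cvec (y - s + r *\<^sub>R s)) \<noteq> 0"
    using eventually_happens[of _ "at (0::real)"] by auto
  moreover have "y - s + r *\<^sub>R s = (y + r *\<^sub>R s) - s" by simp
  ultimately show ?thesis by (intro exI[of _ "y + r *\<^sub>R s"]) simp
qed

text \<open>If the ambiguity function vanished for all frequencies, Fourier uniqueness and
  continuity would make the shifted window product vanish everywhere. From one nonzero frequency
  \<open>w0\<close>, analyticity on the line joining \<open>w\<close> to \<open>w0\<close> gives
  nonzero values arbitrarily close to \<open>w\<close>.\<close>

lemma window_ambiguity_dense:
  "w \<in> closure {w. stft (\<lambda>t. \<phi> (cvec t)) s w \<noteq> 0}"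
proof -
  note [measurable] = measurable_window_cvec
  let ?\<psi> = "\<lambda>t. \<phi> (cvec t)"
  have "\<exists>w0. stft ?\<psi> s w0 \<noteq> 0"
  proof (rule ccontr)
    assume "\<not> ?thesis"
    moreover have "integrable lborel (\<lambda>t. \<phi> (cvec (t - s)) * cnj (\<phi> (cvec t)))"
      using square_integrable_window integrable_translate[OF square_integrable_window, of s]
      by (intro integrable_prod_square_integrable) auto
    ultimately have ae: "AE t in lborel. \<phi> (cvec (t - s)) * cnj (\<phi> (cvec t)) = 0"
      unfolding stft_def by (intro fourier_uniqueness) auto
    \<comment> \<open>An open Lebesgue null set is empty, which upgrades vanishing almost everywhere
      to vanishing everywhere.\<close>
    let ?U = "{t. \<phi> (cvec (t - s)) * cnj (\<phi> (cvec t)) \<noteq> 0}"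
    have op: "open ?U"
      by (intro open_Collect_neq continuous_intros continuous_window)
    have "?U \<in> null_sets lborel"
      using ae op by (subst AE_iff_null_sets) auto
    then have "negligible ?U"
      by (auto simp: negligible_iff_null_sets intro: null_sets_completionI)
    then have "?U = {}"
      using open_not_negligible[OF op] by blast
    then show False
      using window_shift_product_nonzero[of s] by blast
  qed
  then obtain w0 where w0: "stft ?\<psi> s w0 \<noteq> 0" by blast
  have "eventually (\<lambda>r. V ?\<psi> s w 0 (w0 - w) (complex_of_real r) \<noteq> 0) (at 0)"
  proof (rule eventually_nonzero_on_reals[where a="complex_of_real 1"])
    show "V ?\<psi> s w 0 (w0 - w) holomorphic_on UNIV"
      by (rule holomorphic_V[OF measurable_window_cvec square_integrable_window])
    show "V ?\<psi> s w 0 (w0 - w) (complex_of_real 1) \<noteq> 0"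
      unfolding V_of_real using w0 by simp
  qed
  then have "eventually (\<lambda>r. w + r *\<^sub>R (w0 - w) \<in> {w. stft ?\<psi> s w \<noteq> 0}) (at 0)"
    by (simp add: V_of_real)
  then have "eventually (\<lambda>r. w + r *\<^sub>R (w0 - w) \<in> closure {w. stft ?\<psi> s w \<noteq> 0}) (at 0)"
    by (rule eventually_mono) (rule subsetD[OF closure_subset])
  moreover have "((\<lambda>r. w + r *\<^sub>R (w0 - w)) \<longlongrightarrow> w + 0 *\<^sub>R (w0 - w)) (at (0::real))"
    by (intro tendsto_intros)
  ultimately have "w + 0 *\<^sub>R (w0 - w) \<in> closure {w. stft ?\<psi> s w \<noteq> 0}"
    by (intro Lim_in_closed_set[OF closed_closure, of _ _ "at (0::real)"]) auto
  then show ?thesis by simp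
qed

lemma stft_phase_retrieval:
  assumes f: "f \<in> borel_measurable borel" "integrable lborel (\<lambda>t. (cmod (f t))\<^sup>2)"
    and h: "h \<in> borel_measurable borel" "integrable lborel (\<lambda>t. (cmod (h t))\<^sup>2)"
    and eq: "\<And>x w. cmod (stft f x w) = cmod (stft h x w)"
  shows "\<exists>c. cmod c = 1 \<and> (AE t in lborel. f t = c * h t)"
proof (rule phase_retrieval_full[where \<phi>="\<lambda>t. \<phi> (cvec t)"])
  show "cmod (\<phi> (cvec t)) \<le> C" for t
    using window_norm_le[of t] qm_nonneg[of t] C mult_left_mono[of "exp (- qm t)" 1 C]
    by (intro order_trans[OF window_norm_le]) auto
  show "w \<in> closure {w. (LINT t|lborel. exp (\<i> * complex_of_real (t \<bullet> w)) * (\<phi> (cvec (t - s)) * cnj (\<phi> (cvec t)))) \<noteq> 0}"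
    for s w
    using window_ambiguity_dense[of w s] unfolding stft_def .
qed (use f h eq in \<open>auto simp: continuous_on_window_cvec integrable_window stft_def\<close>)

end

text \<open>Induction on the set \<open>T\<close> of coordinates freed from the lattice. Freeing one
  more coordinate uses the one-variable theorem on the axis-parallel line through \<open>p\<close>;
  on its lattice points the induction hypothesis applies.\<close>

lemma zero_if_zero_on_sqrt_lattice:
  fixes D :: "real ^ 'k \<Rightarrow> real" and \<rho> :: "real ^ 'k"
  assumes line: "\<And>p i. \<exists>F B \<sigma>. F holomorphic_on UNIV \<and> (\<forall>z. norm (F z) \<le> B * exp (\<sigma> * (norm z)\<^sup>2))
      \<and> \<sigma> \<ge> 0 \<and> \<sigma> * (\<rho> $ i)\<^sup>2 * exp 1 < 1
      \<and> (\<forall>r. F (complex_of_real r) = complex_of_real (D (p + r *\<^sub>R axis i 1)))"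
    and \<rho>: "\<And>i. \<rho> $ i > 0"
    and zero: "\<And>p. (\<And>i. p $ i \<in> (*) (\<rho> $ i) ` sqrt_ints) \<Longrightarrow> D p = 0"
  shows "D p = 0"
proof -
  have "D p = 0" if "finite T" "\<And>i. i \<notin> T \<Longrightarrow> p $ i \<in> (*) (\<rho> $ i) ` sqrt_ints" for T p
    using that
  proof (induction T arbitrary: p rule: finite_induct)
    case empty
    then show ?case using zero by blast
  next
    case (insert i T)
    \<comment> \<open>Coordinate \<open>i\<close> is reset to 0 so that the line parameter is the
      coordinate itself and the zeros sit at the undisplaced lattice points.\<close>
    let ?p = "p - (p $ i) *\<^sub>R axis i 1"
    obtain F B \<sigma> where F: "F holomorphic_on UNIV" "\<And>z. norm (F z) \<le> B * exp (\<sigma> * (norm z)\<^sup>2)"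
      "\<sigma> \<ge> 0" "\<sigma> * (\<rho> $ i)\<^sup>2 * exp 1 < 1"
      "\<And>r. F (complex_of_real r) = complex_of_real (D (?p + r *\<^sub>R axis i 1))"
      using line[of i ?p] by blast
    have "F (complex_of_real (p $ i)) = 0"
    proof (rule entire_zero_on_sqrt_lattice[OF F(1,2) \<rho>[of i] F(3,4)])
      fix r assume r: "r \<in> sqrt_ints"
      have "D (?p + (\<rho> $ i * r) *\<^sub>R axis i 1) = 0"
      proof (rule insert.IH)
        fix l assume l: "l \<notin> T"
        show "(?p + (\<rho> $ i * r) *\<^sub>R axis i 1) $ l \<in> (*) (\<rho> $ l) ` sqrt_ints"
          using insert.prems[of l] l r by (cases "l = i") (auto simp: axis_def)
      qed
      then show "F (complex_of_real (\<rho> $ i * r)) = 0" by (simp only: F(5)) simp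
    qed
    then show ?case by (simp add: F(5))
  qed
  from this[of UNIV p] show ?thesis by simp
qed

text \<open>Provides Borel representatives of elements of L2, on which the Fubini arguments over
  \<open>lborel\<close> operate.\<close>

lemma lebesgue_measurable_AE_eq_borel:
  fixes f :: "'a::euclidean_space \<Rightarrow> complex"
  assumes f: "f \<in> borel_measurable lebesgue"
  obtains g where "g \<in> borel_measurable borel" "AE t in lborel. f t = g t"
proof -
  have "(\<lambda>t. Re (f t)) \<in> borel_measurable (completion lborel)" "(\<lambda>t. Im (f t)) \<in> borel_measurable (completion lborel)"
    using f by auto
  from this[THEN completion_ex_borel_measurable_real]
  obtain u v where u: "u \<in> borel_measurable lborel" "AE t in lborel. Re (f t) = u t"
    and v: "v \<in> borel_measurable lborel" "AE t in lborel. Im (f t) = v t" by blast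
  show ?thesis
  proof
    show "(\<lambda>t. Complex (u t) (v t)) \<in> borel_measurable borel"
      using u(1) v(1) by (simp add: borel_measurable_complex_iff)
    show "AE t in lborel. f t = Complex (u t) (v t)"
      using u(2) v(2) by eventually_elim (simp add: complex_eq_iff)
  qed
qed

section \<open>From the square-root lattice to all samples\<close>

lemma gaussian_window_O_space:
  fixes m n :: "real ^ 'd"
  assumes "\<phi> \<in> O_space m n" "\<phi> \<noteq> (\<lambda>_. 0)" "\<forall>j. m $ j > 0" "\<forall>j. n $ j > 0"
  obtains C where "gaussian_window m n \<phi> C"
proof -
  obtain C where C: "entire_fun \<phi>" "C > 0" "\<And>x y. cmod (\<phi> (\<chi> j. complex_of_real (x $ j) + \<i> * complex_of_real (y $ j)))
      \<le> C * (\<Prod>j\<in>UNIV. exp (- (m $ j) * (x $ j)\<^sup>2) * exp (n $ j * (y $ j)\<^sup>2))"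
    using assms(1) unfolding O_space_def by blast
  have "cmod (\<phi> (cvec x + \<i> *s cvec y)) \<le> C * exp (- weighted_square m x + weighted_square n y)" for x y
  proof -
    have "cvec x + \<i> *s cvec y = (\<chi> j. complex_of_real (x $ j) + \<i> * complex_of_real (y $ j))"
      by (simp add: cvec_def vec_eq_iff)
    moreover have "(\<Prod>j\<in>UNIV. exp (- (m $ j) * (x $ j)\<^sup>2) * exp (n $ j * (y $ j)\<^sup>2))
        = exp (- weighted_square m x + weighted_square n y)"
      by (simp add: exp_add[symmetric] exp_sum[symmetric] weighted_square_def sum.distrib sum_negf sum_subtractf)
    ultimately show ?thesis
      using C(3)[of x y] by simp
  qed
  then have "gaussian_window m n \<phi> C"
    using C assms by unfold_locales auto
  then show ?thesis by (rule that)
qed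

lemma sqrt_lattice_diag_matrixI:
  fixes \<tau> v :: "real ^ 'd"
  assumes "\<And>j. p $ Inl j \<in> (*) (\<tau> $ j) ` sqrt_ints" "\<And>j. p $ Inr j \<in> (*) (v $ j) ` sqrt_ints"
  shows "p \<in> sqrt_lattice (diag_matrix \<tau> v)"
proof -
  define \<rho> where "\<rho> = (\<lambda>i. case i of Inl j \<Rightarrow> \<tau> $ j | Inr j \<Rightarrow> v $ j)"
  have "\<exists>r. r \<in> sqrt_ints \<and> p $ i = \<rho> i * r" for i
    using assms by (cases i) (auto simp: \<rho>_def)
  then obtain r where r: "\<And>i. r i \<in> sqrt_ints" "\<And>i. p $ i = \<rho> i * r i"
    by metis
  have "diag_matrix \<tau> v *v (\<chi> i. r i) = p"
    using r(2) by (auto simp: vec_eq_iff matrix_vector_mult_def diag_matrix_def \<rho>_def[symmetric]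
        if_distrib[of "\<lambda>x. x * _"] cong: if_cong)
  then show ?thesis
    unfolding sqrt_lattice_def using r(1) by (intro image_eqI[of _ _ "\<chi> i. r i"]) auto
qed

section \<open>Growth rates in the coordinate directions, and reduction of the canonical
  transform\<close>

context gaussian_window
begin

lemma rate_axis_left: "rate (axis j 1) 0 = n $ j"
proof -
  have "(\<Sum>k\<in>UNIV. n $ k * (axis j 1 $ k)\<^sup>2) = (\<Sum>k\<in>UNIV. if k = j then n $ k else 0)"
    by (intro sum.cong) (auto simp: axis_def)
  then show ?thesis
    by (simp add: rate_def weighted_square_def dual_def)
qed

text \<open>The direction carries 1 / b because \<mu> enters the kernel as \<mu> / b. With \<sigma>
  twice this rate, \<sigma> v^2 e < 1 is the assumed bound on v; \<open>rate_axis_left\<close> gives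
  the bound on \<tau> in the same way.\<close>

lemma rate_axis_right: "b \<noteq> 0 \<Longrightarrow> rate 0 ((1 / b) *\<^sub>R axis j 1) = 1 / (4 * m $ j * b\<^sup>2)"
proof -
  assume b: "b \<noteq> 0"
  have "(\<Sum>k\<in>UNIV. m $ k * (dual ((1 / b) *\<^sub>R axis j 1) $ k)\<^sup>2)
      = (\<Sum>k\<in>UNIV. if k = j then 1 / (4 * m $ k * b\<^sup>2) else 0)"
  proof (intro sum.cong refl)
    fix k
    show "m $ k * (dual ((1 / b) *\<^sub>R axis j 1) $ k)\<^sup>2 = (if k = j then 1 / (4 * m $ k * b\<^sup>2) else 0)"
      using m[of k] b by (auto simp: dual_def axis_def power2_eq_square field_simps)
  qed
  then show ?thesis
    by (simp add: rate_def weighted_square_def)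
qed

lemma stft_cong_AE:
  assumes [measurable]: "f \<in> borel_measurable borel" "g \<in> borel_measurable borel"
    and "AE t in lborel. f t = g t"
  shows "stft f x w = stft g x w"
proof -
  have [measurable]: "(\<lambda>t. \<phi> (cvec (t - x))) \<in> borel_measurable borel"
    by (intro borel_measurable_continuous_onI continuous_window continuous_intros)
  show ?thesis
    unfolding stft_def
    by (rule integral_cong_AE) (use assms(3) in auto)
qed

text \<open>The chirp in \<open>t\<close> is absorbed into the signal and the chirp in \<mu> is
  unimodular, so the modulus sees only an ordinary short-time Fourier transform at frequency \<mu> /
  b.\<close>

lemma cmod_STLCT:
  assumes b: "b > 0" and f: "f \<in> borel_measurable lebesgue"
    and [measurable]: "g \<in> borel_measurable borel" and ae: "AE t in lborel. f t = g t"
  shows "cmod (STLCT (a, b, c, d) (real_restriction \<phi>) f (x, \<mu>))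
    = 1 / sqrt b * cmod (stft (\<lambda>t. exp (\<i> * complex_of_real (a / (2 * b) * (t \<bullet> t))) * g t) x ((1 / b) *\<^sub>R \<mu>))"
proof -
  let ?E = "\<lambda>t. exp (\<i> * complex_of_real (a / (2 * b) * (t \<bullet> t) - 1 / b * (t \<bullet> \<mu>) + d / (2 * b) * (\<mu> \<bullet> \<mu>)))
        * cnj (real_restriction \<phi> (t - x))"
  let ?g = "\<lambda>t. exp (\<i> * complex_of_real (a / (2 * b) * (t \<bullet> t))) * g t"
  let ?\<mu> = "(1 / b) *\<^sub>R \<mu>"
  have rr: "real_restriction \<phi> t = \<phi> (cvec t)" for t
    by (simp add: real_restriction_def cvec_def)
  have [measurable]: "?E \<in> borel_measurable borel"
    unfolding rr by (intro borel_measurable_continuous_onI continuous_intros continuous_window)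
  have E: "?E \<in> borel_measurable lebesgue"
    by (rule measurable_completion) measurable
  have g: "g \<in> borel_measurable lebesgue"
    by (rule measurable_completion) measurable
  have "(LINT t|lebesgue. ?E t * f t) = (LINT t|lebesgue. ?E t * g t)"
    using AE_completion[OF ae] by (intro integral_cong_AE borel_measurable_times E f g) auto
  also have "\<dots> = (LINT t|lborel. ?E t * g t)"
    by (rule integral_completion) measurable
  \<comment> \<open>The integrand is written as a conjugate, which moves the conjugation from the
    window to the signal and flips the sign of the frequency, as \<open>stft\<close>
    requires.\<close>
  also have "\<dots> = (LINT t|lborel. exp (\<i> * complex_of_real (d / (2 * b) * (\<mu> \<bullet> \<mu>)))
      * cnj (cnj (exp (- \<i> * complex_of_real (t \<bullet> ?\<mu>))) * (\<phi> (cvec (t - x)) * cnj (?g t))))"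
    by (intro Bochner_Integration.integral_cong refl)
       (simp add: rr exp_add[symmetric] exp_diff[symmetric] algebra_simps)
  also have "\<dots> = exp (\<i> * complex_of_real (d / (2 * b) * (\<mu> \<bullet> \<mu>)))
      * cnj (LINT t|lborel. cnj (exp (- \<i> * complex_of_real (t \<bullet> ?\<mu>))) * (\<phi> (cvec (t - x)) * cnj (?g t)))"
    by (simp only: integral_mult_right_zero Bochner_Integration.integral_cnj)
  also have "(LINT t|lborel. cnj (exp (- \<i> * complex_of_real (t \<bullet> ?\<mu>))) * (\<phi> (cvec (t - x)) * cnj (?g t)))
      = stft ?g x ?\<mu>"
    unfolding stft_def by (simp add: exp_cnj)
  finally have "STLCT (a, b, c, d) (real_restriction \<phi>) f (x, \<mu>)
      = 1 / csqrt (complex_of_real b) * (exp (\<i> * complex_of_real (d / (2 * b) * (\<mu> \<bullet> \<mu>))) * cnj (stft ?g x ?\<mu>))"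
    by simp
  moreover have "cmod (csqrt (complex_of_real b)) = sqrt b"
    using b by (simp add: norm_csqrt)
  moreover have "cmod (exp (\<i> * complex_of_real (d / (2 * b) * (\<mu> \<bullet> \<mu>)))) = 1"
    by (rule norm_exp_i_times)
  ultimately show ?thesis
    by (simp only: norm_mult norm_divide complex_mod_cnj norm_one mult_1)
qed

end

theorem theorem1p1:
  fixes a b c d :: real
    and m n \<tau> v :: "real ^ 'd"
    and \<phi> :: "complex ^ 'd \<Rightarrow> complex"
    and f h :: "real ^ 'd \<Rightarrow> complex"
  assumes "a * d - b * c = 1" and "b \<noteq> 0"
    and "\<forall>j. m $ j > 0" and "\<forall>j. n $ j > 0"
    and "\<phi> \<in> O_space m n" and "\<phi> \<noteq> (\<lambda>_. 0)"
    and "\<forall>j. \<tau> $ j > 0" and "\<forall>j. v $ j > 0"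
    and "\<forall>j. \<tau> $ j < 1 / sqrt (2 * n $ j * exp 1)"
    and "\<forall>j. v $ j < b * sqrt (2 * m $ j / exp 1)"
    and "L2_fun f" and "L2_fun h"
  shows "(\<forall>p \<in> sqrt_lattice (diag_matrix \<tau> v).
            cmod (STLCT (a, b, c, d) (real_restriction \<phi>) f (split_point p))
              = cmod (STLCT (a, b, c, d) (real_restriction \<phi>) h (split_point p)))
         \<longleftrightarrow> f \<sim>\<^sub>p h"
proof -
  obtain C where "gaussian_window m n \<phi> C"
    using gaussian_window_O_space assms by blast
  then interpret gaussian_window m n \<phi> C .
  \<comment> \<open>Positivity is implied by the hypotheses on v, since 0 < v_j < b times a positive
    square root for an index j.\<close>
  have b: "b > 0"
  proof -
    fix j
    have "0 < b * sqrt (2 * m $ j / exp 1)"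
      using assms(8,10) by (meson less_trans)
    moreover have "sqrt (2 * m $ j / exp 1) > 0"
      using m[of j] by simp
    ultimately show ?thesis
      by (simp add: zero_less_mult_iff)
  qed
  have L2: "\<exists>g. g \<in> borel_measurable borel \<and> (AE t in lborel. k t = g t) \<and> integrable lborel (\<lambda>t. (cmod (g t))\<^sup>2)"
    if k: "L2_fun k" for k :: "real ^ 'd \<Rightarrow> complex"
  proof -
    obtain g where g[measurable]: "g \<in> borel_measurable borel" and ae: "AE t in lborel. k t = g t"
      using k lebesgue_measurable_AE_eq_borel unfolding L2_fun_def by blast
    have [measurable]: "(\<lambda>t. (cmod (g t))\<^sup>2) \<in> borel_measurable lborel" by measurable
    have "integrable lebesgue (\<lambda>t. (cmod (g t))\<^sup>2)"
    proof (subst integrable_cong_AE)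
      show "AE t in lebesgue. (cmod (g t))\<^sup>2 = (cmod (k t))\<^sup>2"
        using AE_completion[OF ae] by eventually_elim simp
      show "(\<lambda>t. (cmod (g t))\<^sup>2) \<in> borel_measurable lebesgue"
        by (rule measurable_completion) measurable
    qed (use k in \<open>auto simp: L2_fun_def\<close>)
    then have "integrable lborel (\<lambda>t. (cmod (g t))\<^sup>2)"
      by (subst (asm) integrable_completion) measurable
    then show ?thesis using g ae by blast
  qed
  obtain f' where f'[measurable]: "f' \<in> borel_measurable borel" and aef: "AE t in lborel. f t = f' t"
    and f2: "integrable lborel (\<lambda>t. (cmod (f' t))\<^sup>2)"
    using L2[OF assms(11)] by blast
  obtain h' where h'[measurable]: "h' \<in> borel_measurable borel" and aeh: "AE t in lborel. h t = h' t"
    and h2: "integrable lborel (\<lambda>t. (cmod (h' t))\<^sup>2)"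
    using L2[OF assms(12)] by blast
  have fl: "f \<in> borel_measurable lebesgue" and hl: "h \<in> borel_measurable lebesgue"
    using assms(11,12) by (auto simp: L2_fun_def)
  define e where "e = (\<lambda>t::real^'d. exp (\<i> * complex_of_real (a / (2 * b) * (t \<bullet> t))))"
  have e: "e t \<noteq> 0" "cmod (e t) = 1" for t by (simp_all add: e_def)
  have [measurable]: "e \<in> borel_measurable borel" unfolding e_def by measurable
  have ef: "(\<lambda>t. e t * f' t) \<in> borel_measurable borel" "integrable lborel (\<lambda>t. (cmod (e t * f' t))\<^sup>2)"
    and eh: "(\<lambda>t. e t * h' t) \<in> borel_measurable borel" "integrable lborel (\<lambda>t. (cmod (e t * h' t))\<^sup>2)"
    using f2 h2 by (auto simp: norm_mult e)
  define Vf where "Vf = stft (\<lambda>t. e t * f' t)"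
  define Vh where "Vh = stft (\<lambda>t. e t * h' t)"
  have f_eq: "cmod (STLCT (a, b, c, d) (real_restriction \<phi>) f (x, \<mu>)) = 1 / sqrt b * cmod (Vf x ((1 / b) *\<^sub>R \<mu>))"
    and h_eq: "cmod (STLCT (a, b, c, d) (real_restriction \<phi>) h (x, \<mu>)) = 1 / sqrt b * cmod (Vh x ((1 / b) *\<^sub>R \<mu>))" for x \<mu>
    unfolding Vf_def Vh_def e_def
    by (intro cmod_STLCT b fl hl f' h' aef aeh)+
  have eq_iff: "cmod (STLCT (a, b, c, d) (real_restriction \<phi>) f (x, \<mu>)) = cmod (STLCT (a, b, c, d) (real_restriction \<phi>) h (x, \<mu>))
      \<longleftrightarrow> cmod (Vf x ((1 / b) *\<^sub>R \<mu>)) = cmod (Vh x ((1 / b) *\<^sub>R \<mu>))" for x \<mu>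
    unfolding f_eq h_eq using b by simp
  show ?thesis
  proof
    assume lattice: "\<forall>p \<in> sqrt_lattice (diag_matrix \<tau> v).
            cmod (STLCT (a, b, c, d) (real_restriction \<phi>) f (split_point p))
              = cmod (STLCT (a, b, c, d) (real_restriction \<phi>) h (split_point p))"
    define X where "X = (\<lambda>p::real^('d + 'd). (\<chi> j. p $ Inl j))"
    define W where "W = (\<lambda>p::real^('d + 'd). (1 / b) *\<^sub>R (\<chi> j. p $ Inr j))"
    define D where "D = (\<lambda>p. (cmod (Vf (X p) (W p)))\<^sup>2 - (cmod (Vh (X p) (W p)))\<^sup>2)"
    define \<rho> where "\<rho> = (\<chi> i. case i of Inl j \<Rightarrow> \<tau> $ j | Inr j \<Rightarrow> v $ j)"
    have D0: "D p = 0" for p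
    proof (rule zero_if_zero_on_sqrt_lattice[where \<rho>=\<rho>])
      show "\<rho> $ i > 0" for i
        using assms(7,8) by (cases i) (auto simp: \<rho>_def)
      show "D p = 0" if p: "\<And>i. p $ i \<in> (*) (\<rho> $ i) ` sqrt_ints" for p
      proof -
        have "p \<in> sqrt_lattice (diag_matrix \<tau> v)"
          using p[of "Inl _"] p[of "Inr _"] by (intro sqrt_lattice_diag_matrixI) (auto simp: \<rho>_def)
        then have "cmod (Vf (X p) (W p)) = cmod (Vh (X p) (W p))"
          using lattice unfolding split_point_def eq_iff X_def W_def by simp
        then show ?thesis by (simp add: D_def)
      qed
      fix p :: "real ^ ('d + 'd)" and i :: "'d + 'd"
      \<comment> \<open>A step along axis \<open>i\<close> of the doubled space moves either the
        position or the frequency, never both; the frequency moves at speed 1 / b.\<close>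
      define \<alpha> where "\<alpha> = (case i of Inl j \<Rightarrow> axis j 1 | Inr j \<Rightarrow> (0 :: real ^ 'd))"
      define \<beta> where "\<beta> = (case i of Inl j \<Rightarrow> (0 :: real ^ 'd) | Inr j \<Rightarrow> (1 / b) *\<^sub>R axis j 1)"
      have XW: "X (p + r *\<^sub>R axis i 1) = X p + r *\<^sub>R \<alpha>" "W (p + r *\<^sub>R axis i 1) = W p + r *\<^sub>R \<beta>" for r
        by (cases i; auto simp: X_def W_def \<alpha>_def \<beta>_def vec_eq_iff axis_def algebra_simps)+
      have rate: "2 * rate \<alpha> \<beta> * (\<rho> $ i)\<^sup>2 * exp 1 < 1"
      proof (cases i)
        case (Inl j)
        have "(\<tau> $ j)\<^sup>2 < (1 / sqrt (2 * n $ j * exp 1))\<^sup>2"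
          using assms(7,9) by (intro power_strict_mono) (auto simp: less_imp_le)
        also have "\<dots> = 1 / (2 * n $ j * exp 1)"
          using n[of j] by (simp add: power_divide)
        finally show ?thesis
          using n[of j] by (simp add: Inl \<alpha>_def \<beta>_def \<rho>_def rate_axis_left field_simps)
      next
        case (Inr j)
        have "(v $ j)\<^sup>2 < (b * sqrt (2 * m $ j / exp 1))\<^sup>2"
          using assms(8,10) by (intro power_strict_mono) (auto simp: less_imp_le)
        also have "\<dots> = b\<^sup>2 * (2 * m $ j / exp 1)"
          using m[of j] by (simp add: power_mult_distrib)
        finally show ?thesis
          using m[of j] b by (simp add: Inr \<alpha>_def \<beta>_def \<rho>_def rate_axis_right field_simps)
      qed
      obtain Q B where Q: "Q holomorphic_on UNIV" "\<And>z. norm (Q z) \<le> B * exp (2 * rate \<alpha> \<beta> * (norm z)\<^sup>2)"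
        "\<And>r. Q (complex_of_real r) = complex_of_real ((cmod (Vf (X p + r *\<^sub>R \<alpha>) (W p + r *\<^sub>R \<beta>)))\<^sup>2)"
        using stft_square_line[OF ef] unfolding Vf_def by blast
      obtain Q' B' where Q': "Q' holomorphic_on UNIV" "\<And>z. norm (Q' z) \<le> B' * exp (2 * rate \<alpha> \<beta> * (norm z)\<^sup>2)"
        "\<And>r. Q' (complex_of_real r) = complex_of_real ((cmod (Vh (X p + r *\<^sub>R \<alpha>) (W p + r *\<^sub>R \<beta>)))\<^sup>2)"
        using stft_square_line[OF eh] unfolding Vh_def by blast
      have "(\<lambda>z. Q z - Q' z) holomorphic_on UNIV"
        by (intro holomorphic_intros Q Q')
      moreover have "norm (Q z - Q' z) \<le> (B + B') * exp (2 * rate \<alpha> \<beta> * (norm z)\<^sup>2)" for z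
        using norm_triangle_ineq4[of "Q z" "Q' z"] Q(2)[of z] Q'(2)[of z] by (simp add: distrib_right)
      moreover have "Q (complex_of_real r) - Q' (complex_of_real r) = complex_of_real (D (p + r *\<^sub>R axis i 1))" for r
        by (simp add: Q Q' D_def XW)
      ultimately show "\<exists>F B \<sigma>. F holomorphic_on UNIV \<and> (\<forall>z. norm (F z) \<le> B * exp (\<sigma> * (norm z)\<^sup>2))
          \<and> \<sigma> \<ge> 0 \<and> \<sigma> * (\<rho> $ i)\<^sup>2 * exp 1 < 1
          \<and> (\<forall>r. F (complex_of_real r) = complex_of_real (D (p + r *\<^sub>R axis i 1)))"
        using rate rate_nonneg
        by (intro exI[of _ "\<lambda>z. Q z - Q' z"] exI[of _ "B + B'"] exI[of _ "2 * rate \<alpha> \<beta>"]) auto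
    qed
    have "cmod (Vf x w) = cmod (Vh x w)" for x w
    proof -
      \<comment> \<open>The factor \<open>b\<close> undoes the dilation in \<open>W\<close>, so
        every position and frequency is reached.\<close>
      define p where "p = (\<chi> i. case i of Inl j \<Rightarrow> x $ j | Inr j \<Rightarrow> b * w $ j)"
      have "X p = x" "W p = w"
        using b by (auto simp: X_def W_def p_def vec_eq_iff)
      with D0[of p] have "(cmod (Vf x w))\<^sup>2 = (cmod (Vh x w))\<^sup>2"
        by (simp add: D_def)
      then show ?thesis by (simp add: power2_eq_iff_nonneg)
    qed
    then obtain k where k: "cmod k = 1" "AE t in lborel. e t * f' t = k * (e t * h' t)"
      using stft_phase_retrieval[OF ef eh] unfolding Vf_def Vh_def by blast
    from k(2) aef aeh have "AE t in lborel. f t = k * h t"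
      by eventually_elim (use e in auto)
    then show "f \<sim>\<^sub>p h"
      unfolding phase_equiv_def using k(1) AE_completion by blast
  next
    assume "f \<sim>\<^sub>p h"
    then obtain k where k: "cmod k = 1" "AE t in lborel. f t = k * h t"
      unfolding phase_equiv_def AE_completion_iff by blast
    from k(2) aef aeh have "AE t in lborel. e t * f' t = k * (e t * h' t)"
      by eventually_elim auto
    then have "Vf x w = stft (\<lambda>t. k * (e t * h' t)) x w" for x w
      unfolding Vf_def by (intro stft_cong_AE) auto
    \<comment> \<open>\<open>stft\<close> is antilinear in the signal, so the phase leaves it
      conjugated.\<close>
    also have "stft (\<lambda>t. k * (e t * h' t)) x w = cnj k * Vh x w" for x w
      unfolding Vh_def stft_def
      by (subst integral_mult_right_zero[symmetric]) (simp add: ac_simps)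
    finally have "cmod (Vf x w) = cmod (Vh x w)" for x w
      using k(1) by (simp add: norm_mult)
    then show "\<forall>p \<in> sqrt_lattice (diag_matrix \<tau> v).
            cmod (STLCT (a, b, c, d) (real_restriction \<phi>) f (split_point p))
              = cmod (STLCT (a, b, c, d) (real_restriction \<phi>) h (split_point p))"
      unfolding split_point_def eq_iff by blast
  qed
qed

end
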